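(* Let $g\in K[[X]][Y]$ be a square-free monic polynomial of degree $m\geq1$ in $Y$. For each $d=1,\dots,m-1$, let a monic polynomial $p_d\in K[[X]][Y]$ of degree $d$ in $Y$ and an integer $e_d$ be given. Then $$\left\{1=p_0,\frac{p_1(x,y)}{x^{e_1}},\ldots,\frac{p_{m-1}(x,y)}{x^{e_{m-1}}}\right\}$$ is an integral basis for $g$ if and only if $e_d=e_g(p_d)=e_{g,d}$ for $d=1,\dots,m-1$.
   Context: $K$ is a field of characteristic zero and $K\subset L$ is a field extension with $L$ algebraically closed. $L\{\{X\}\}=\bigcup_{k\ge1}L((X^{1/k}))$ is the (algebraically closed) field of Puiseux series over $L$. For $\gamma\in L\{\{X\}\}\setminus\{0\}$, $\upsilon(\gamma)\in\mathbb{Q}$ is the smallest exponent appearing in a term of $\gamma$, and $\upsilon(0)=\infty$. The Puiseux expansions of $g$ are its roots $\gamma_1,\dots,\gamma_m\in L\{\{X\}\}$. For $q\in L\{\{X\}\}[Y]$ put $\upsilon_g(q)=\min_{1\le i\le m}\upsilon(q(X,\gamma_i))$. For $q\in K[[X]][Y]$ monic of degree $0\le d\le m-1$ in $Y$, the integrality exponent of $q$ with respect to $g$ is $e_g(q)=\lfloor\upsilon_g(q)\rfloor$, and the maximal integrality exponent with respect to $g$ in degree $d$ is $$e_{g,d}=\max\{e_g(q)\mid q\in K[[X]][Y]\text{ monic in }Y,\ \deg_Y q=d\}.$$ Let $B=K[[x]][y]=K[[X]][Y]/\langle g\rangle$, with $x,y$ the residue classes of $X,Y$. The normalization $\overline{B}$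 is the integral closure of $B$ in its total ring of fractions $K((X))[Y]/\langle g\rangle$; it is a free $K[[x]]$-module of rank $m$. An integral basis for $g$ is a set of free generators of $\overline{B}$ as a $K[[x]]$-module. *)

theory Defs
  imports
    "HOL-Algebra.Algebraic_Closure_Type"
    "HOL-Library.Extended"
begin

section \<open>Puiseux series\<close>

text \<open>The coefficient function of \<open>F(X\<^bsup>1/k\<^esup>)\<close> for a Laurent series \<open>F\<close> and \<open>k > 0\<close>.\<close>

definition puiseux_nth :: "nat \<Rightarrow> 'a::zero fls \<Rightarrow> rat \<Rightarrow> 'a" where
  "puiseux_nth k F r = (if of_nat k * r \<in> \<int> then fls_nth F \<lfloor>of_nat k * r\<rfloor> else 0)"

text \<open>A Puiseux series is represented by its coefficient function on rational exponents; the
  type is the union of the fields of Laurent series in \<open>X\<^bsup>1/k\<^esup>\<close> over all \<open>k \<ge> 1\<close>.\<close>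

typedef (overloaded) 'a puiseux = "{f :: rat \<Rightarrow> 'a::zero. \<exists>k>0. \<exists>F. f = puiseux_nth k F}"
  morphisms pcoeff Abs_puiseux
  by blast

text \<open>\<open>F(X\<^bsup>1/k\<^esup>)\<close> as a Puiseux series (meaningful for \<open>k > 0\<close>)\<close>

definition puiseux_of_fls :: "nat \<Rightarrow> 'a::zero fls \<Rightarrow> 'a puiseux" where
  "puiseux_of_fls k F = Abs_puiseux (puiseux_nth k F)"

lemma pcoeff_of_fls: "k > 0 \<Longrightarrow> pcoeff (puiseux_of_fls k F) = puiseux_nth k F"
  unfolding puiseux_of_fls_def by (rule Abs_puiseux_inverse) blast

lemma puiseux_eqI: "(\<And>r. pcoeff f r = pcoeff g r) \<Longrightarrow> f = g"
  by (simp add: pcoeff_inject[symmetric] fun_eq_iff)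

lemma puiseux_cases: obtains k F where "k > 0" "f = puiseux_of_fls k F"
proof -
  from pcoeff[of f] obtain k F where "k > 0" "pcoeff f = puiseux_nth k F" by auto
  then have "f = puiseux_of_fls k F"
    by (metis puiseux_of_fls_def pcoeff_inverse)
  with \<open>k > 0\<close> that show ?thesis by blast
qed

lemma puiseux_of_fls_refine:
  assumes "k > 0" "l > 0"
  shows "\<exists>G. puiseux_of_fls k F = puiseux_of_fls (k * l) G"
proof -
  define h where "h = (\<lambda>n::int. if int l dvd n then fls_nth F (n div int l) else 0)"
  define G where "G = Abs_fls h"
  have "\<forall>n < min 0 (fls_subdegree F) * int l. h n = 0"
  proof (intro allI impI)
    fix n assume n: "n < min 0 (fls_subdegree F) * int l"
    show "h n = 0"
    proof (cases "int l dvd n")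
      case True
      then obtain c where c: "n = int l * c" by (elim dvdE)
      with n have "int l * c < int l * min 0 (fls_subdegree F)" by (simp add: mult.commute)
      then have "c < min 0 (fls_subdegree F)" by (simp add: \<open>l > 0\<close>)
      then show ?thesis using c \<open>l > 0\<close> by (simp add: h_def)
    qed (simp add: h_def)
  qed
  then have G: "fls_nth G n = h n" for n
    unfolding G_def by (intro nth_Abs_fls_ex_lower_bound) blast
  have "puiseux_nth k F r = puiseux_nth (k * l) G r" for r
  proof (cases "of_nat (k * l) * r \<in> \<int>")
    case True
    then obtain n where n: "of_nat (k * l) * r = of_int n" by (elim Ints_cases)
    then have kr: "of_nat k * r = of_int n / of_nat l" using \<open>l > 0\<close> by (simp add: field_simps)
    have lhs: "of_nat k * r \<in> \<int> \<longleftrightarrow> int l dvd n"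
    proof
      assume "of_nat k * r \<in> \<int>"
      then obtain c where "of_nat k * r = of_int c" by (elim Ints_cases)
      moreover have "of_int n = (of_nat k * r) * of_nat l" using n by (simp add: mult_ac)
      ultimately have "(of_int n :: rat) = of_int (c * int l)" by simp
      then show "int l dvd n" by (metis of_int_eq_iff dvd_triv_right)
    next
      assume "int l dvd n"
      then obtain c where "n = int l * c" by (elim dvdE)
      with kr \<open>l > 0\<close> show "of_nat k * r \<in> \<int>" by simp
    qed
    have "\<lfloor>of_nat k * r\<rfloor> = n div int l"
      unfolding kr using floor_divide_of_int_eq[of n "int l"] by simp
    with lhs n show ?thesis by (simp add: puiseux_nth_def G h_def)
  next
    case False
    have "of_nat k * r \<notin> \<int>"
    proof
      assume "of_nat k * r \<in> \<int>"
      then have "of_nat l * (of_nat k * r) \<in> \<int>" by (rule Ints_mult[OF Ints_of_nat])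
      with False show False by (simp add: algebra_simps)
    qed
    with False show ?thesis by (simp only: puiseux_nth_def if_False)
  qed
  then have "puiseux_nth k F = puiseux_nth (k * l) G" by blast
  then show ?thesis unfolding puiseux_of_fls_def by auto
qed

lemma puiseux_cases2:
  obtains k F G where "k > 0" "f = puiseux_of_fls k F" "g = puiseux_of_fls k G"
proof -
  obtain k F where f: "k > 0" "f = puiseux_of_fls k F" by (rule puiseux_cases)
  obtain l G where g: "l > 0" "g = puiseux_of_fls l G" by (rule puiseux_cases)
  from puiseux_of_fls_refine[OF f(1) g(1), of F] f(2)
  obtain F' where "f = puiseux_of_fls (k * l) F'" by auto
  moreover from puiseux_of_fls_refine[OF g(1) f(1), of G] g(2)
  obtain G' where "g = puiseux_of_fls (k * l) G'" by (auto simp: mult.commute)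
  ultimately show ?thesis using f(1) g(1) by (intro that[of "k * l" F' G']) simp_all
qed

lemma puiseux_cases3:
  obtains k F G H
  where "k > 0" "f = puiseux_of_fls k F" "g = puiseux_of_fls k G" "h = puiseux_of_fls k H"
proof -
  obtain k F G where fg: "k > 0" "f = puiseux_of_fls k F" "g = puiseux_of_fls k G"
    by (rule puiseux_cases2)
  obtain l H where h: "l > 0" "h = puiseux_of_fls l H" by (rule puiseux_cases)
  from puiseux_of_fls_refine[OF fg(1) h(1), of F] fg(2)
  obtain F' where "f = puiseux_of_fls (k * l) F'" by auto
  moreover from puiseux_of_fls_refine[OF fg(1) h(1), of G] fg(3)
  obtain G' where "g = puiseux_of_fls (k * l) G'" by auto
  moreover from puiseux_of_fls_refine[OF h(1) fg(1), of H] h(2)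
  obtain H' where "h = puiseux_of_fls (k * l) H'" by (auto simp: mult.commute)
  ultimately show ?thesis using fg(1) h(1) by (intro that[of "k * l" F' G' H']) simp_all
qed

lemma puiseux_of_fls_inject:
  assumes "k > 0"
  shows "puiseux_of_fls k F = puiseux_of_fls k G \<longleftrightarrow> F = G"
proof
  assume eq: "puiseux_of_fls k F = puiseux_of_fls k G"
  show "F = G"
  proof (rule fls_eqI)
    fix n
    have "pcoeff (puiseux_of_fls k F) (of_int n / of_nat k)
        = pcoeff (puiseux_of_fls k G) (of_int n / of_nat k)" by (simp add: eq)
    then show "fls_nth F n = fls_nth G n"
      using assms by (simp add: pcoeff_of_fls puiseux_nth_def)
  qed
qed simp

subsection \<open>Field structure\<close>

instantiation puiseux :: (zero) zero
begin
definition zero_puiseux_def: "0 = Abs_puiseux (\<lambda>_. 0 :: 'a)"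
instance ..
end

instantiation puiseux :: ("{zero,one}") one
begin
definition one_puiseux_def: "1 = Abs_puiseux (\<lambda>r. if r = 0 then 1 else (0 :: 'a))"
instance ..
end

instantiation puiseux :: (monoid_add) plus
begin
definition plus_puiseux_def: "f + g = Abs_puiseux (\<lambda>r. pcoeff f r + pcoeff g r)"
instance ..
end

instantiation puiseux :: (group_add) "{minus,uminus}"
begin
definition uminus_puiseux_def: "- f = Abs_puiseux (\<lambda>r. - pcoeff f r)"
definition minus_puiseux_def: "f - g = Abs_puiseux (\<lambda>r. pcoeff f r - pcoeff g r)"
instance ..
end

instantiation puiseux :: (semiring_0) times
begin
text \<open>Cauchy product; the index set is finite for any two Puiseux series.\<close>
definition times_puiseux_def:
  "f * g = Abs_puiseux (\<lambda>r. \<Sum>s | pcoeff f s \<noteq> 0 \<and> pcoeff g (r - s) \<noteq> 0.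
                              pcoeff f s * pcoeff g (r - s))"
instance ..
end

lemma puiseux_of_fls_0: "puiseux_of_fls k 0 = 0"
  unfolding puiseux_of_fls_def zero_puiseux_def
  by (rule arg_cong[of _ _ Abs_puiseux]) (simp add: puiseux_nth_def fun_eq_iff)

lemma puiseux_of_fls_1:
  assumes "k > 0"
  shows "puiseux_of_fls k (1 :: 'a::{zero,one} fls) = 1"
proof -
  have "puiseux_nth k 1 r = (if r = 0 then 1 else (0 :: 'a))" for r
    using assms by (auto simp: puiseux_nth_def elim!: Ints_cases)
  then have "puiseux_nth k 1 = (\<lambda>r. if r = 0 then 1 else (0 :: 'a))" by blast
  then show ?thesis by (simp only: puiseux_of_fls_def one_puiseux_def)
qed

lemma puiseux_of_fls_add:
  "k > 0 \<Longrightarrow> puiseux_of_fls k F + puiseux_of_fls k G = puiseux_of_fls k (F + G)"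
  unfolding plus_puiseux_def pcoeff_of_fls puiseux_of_fls_def[of k "F + G"]
  by (rule arg_cong[of _ _ Abs_puiseux]) (auto simp: puiseux_nth_def fun_eq_iff)

lemma puiseux_of_fls_uminus:
  "k > 0 \<Longrightarrow> - puiseux_of_fls k F = puiseux_of_fls k (- F)"
  unfolding uminus_puiseux_def pcoeff_of_fls puiseux_of_fls_def[of k "- F"]
  by (rule arg_cong[of _ _ Abs_puiseux]) (auto simp: puiseux_nth_def fun_eq_iff)

lemma puiseux_of_fls_diff:
  "k > 0 \<Longrightarrow> puiseux_of_fls k F - puiseux_of_fls k G = puiseux_of_fls k (F - G)"
  unfolding minus_puiseux_def pcoeff_of_fls puiseux_of_fls_def[of k "F - G"]
  by (rule arg_cong[of _ _ Abs_puiseux]) (auto simp: puiseux_nth_def fun_eq_iff)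

lemma puiseux_nth_convolution:
  fixes F G :: "'a::semiring_0 fls"
  assumes "k > 0"
  shows "(\<Sum>s | puiseux_nth k F s \<noteq> 0 \<and> puiseux_nth k G (r - s) \<noteq> 0.
            puiseux_nth k F s * puiseux_nth k G (r - s)) = puiseux_nth k (F * G) r"
    (is "sum ?t ?S = _")
proof (cases "of_nat k * r \<in> \<int>")
  case False
  have "?S = {}"
  proof (rule ccontr)
    assume "?S \<noteq> {}"
    then obtain s where "of_nat k * s \<in> \<int>" "of_nat k * (r - s) \<in> \<int>"
      by (auto simp: puiseux_nth_def split: if_splits)
    then have "of_nat k * s + of_nat k * (r - s) \<in> \<int>" by (rule Ints_add)
    with False show False by (simp add: algebra_simps)
  qed
  then have "sum ?t ?S = 0" by (simp only: sum.empty)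
  with False show ?thesis by (simp only: puiseux_nth_def[of _ _ r] if_False)
next
  case True
  then obtain n where n: "of_nat k * r = of_int n" by (elim Ints_cases)
  let ?I = "{i. fls_nth F i \<noteq> 0 \<and> fls_nth G (n - i) \<noteq> 0}"
  let ?q = "\<lambda>i::int. of_int i / of_nat k :: rat"
  have q1: "puiseux_nth k F (?q i) = fls_nth F i" for i
    using assms by (simp add: puiseux_nth_def)
  have q2: "puiseux_nth k G (r - ?q i) = fls_nth G (n - i)" for i
  proof -
    have "of_nat k * (r - ?q i) = of_int (n - i)" using assms n by (simp add: field_simps)
    then show ?thesis unfolding puiseux_nth_def by (metis Ints_of_int floor_of_int)
  qed
  have S: "?S = ?q ` ?I"
  proof (intro equalityI subsetI)
    fix s assume s: "s \<in> ?S"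
    then have "of_nat k * s \<in> \<int>" by (auto simp: puiseux_nth_def split: if_splits)
    then obtain i where "of_nat k * s = of_int i" by (elim Ints_cases)
    then have "s = ?q i" using assms by (simp add: field_simps)
    with s q1 q2 show "s \<in> ?q ` ?I" by auto
  qed (use q1 q2 in auto)
  have inj: "inj_on ?q ?I" using assms by (auto simp: inj_on_def)
  have "sum ?t ?S = (\<Sum>i\<in>?I. fls_nth F i * fls_nth G (n - i))"
    unfolding S sum.reindex[OF inj] by (simp add: q1 q2)
  also have "\<dots> = (\<Sum>i=fls_subdegree F..n - fls_subdegree G. fls_nth F i * fls_nth G (n - i))"
  proof (rule sum.mono_neutral_left)
    show "?I \<subseteq> {fls_subdegree F..n - fls_subdegree G}"
    proof
      fix i assume "i \<in> ?I"
      then have "fls_subdegree F \<le> i" "fls_subdegree G \<le> n - i"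
        by (auto intro: fls_subdegree_leI)
      then show "i \<in> {fls_subdegree F..n - fls_subdegree G}" by auto
    qed
  qed auto
  also have "\<dots> = fls_nth (F * G) n" by (simp add: fls_times_nth(2))
  finally show ?thesis by (simp add: puiseux_nth_def n)
qed

lemma puiseux_of_fls_mult:
  "k > 0 \<Longrightarrow> puiseux_of_fls k F * puiseux_of_fls k G = puiseux_of_fls k (F * G)"
  by (simp add: times_puiseux_def pcoeff_of_fls puiseux_nth_convolution)
    (simp add: puiseux_of_fls_def)

lemmas puiseux_of_fls_hom =
  puiseux_of_fls_add puiseux_of_fls_uminus puiseux_of_fls_diff puiseux_of_fls_mult

instance puiseux :: (comm_ring_1) comm_ring_1
proof
  fix f g h :: "'a puiseux"
  obtain k F G H where *: "k > 0" "f = puiseux_of_fls k F" "g = puiseux_of_fls k G"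
    "h = puiseux_of_fls k H" by (rule puiseux_cases3)
  have 0: "0 = puiseux_of_fls k 0" and 1: "1 = puiseux_of_fls k 1"
    using *(1) by (simp_all add: puiseux_of_fls_0 puiseux_of_fls_1)
  note s = *(2-) puiseux_of_fls_hom[OF *(1)] puiseux_of_fls_inject[OF *(1)]
  show "f + g + h = f + (g + h)" "f + g = g + f" "0 + f = f" "- f + f = 0" "f - g = f + - g"
    "f * g * h = f * (g * h)" "f * g = g * f" "1 * f = f" "(f + g) * h = f * h + g * h"
    "(0 :: 'a puiseux) \<noteq> 1"
    unfolding 0 1 by (simp_all add: s algebra_simps)
qed

instantiation puiseux :: (field) field
begin
definition inverse_puiseux_def:
  "inverse (f :: 'a puiseux) = (if f = 0 then 0 else (THE g. f * g = 1))"
definition divide_puiseux_def: "(f :: 'a puiseux) div g = f * inverse g"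
instance
proof
  fix f g :: "'a puiseux"
  assume "f \<noteq> 0"
  obtain k F where *: "k > 0" "f = puiseux_of_fls k F" by (rule puiseux_cases)
  with \<open>f \<noteq> 0\<close> have "F \<noteq> 0" by (auto simp: puiseux_of_fls_0)
  then have inv: "f * puiseux_of_fls k (inverse F) = 1"
    by (simp add: * puiseux_of_fls_mult puiseux_of_fls_1)
  have "(THE g. f * g = 1) = puiseux_of_fls k (inverse F)"
  proof (rule the_equality[of "\<lambda>g. f * g = 1", OF inv])
    fix g assume "f * g = 1"
    then show "g = puiseux_of_fls k (inverse F)"
      by (metis inv mult.assoc mult.commute mult_1_left)
  qed
  with \<open>f \<noteq> 0\<close> inv show "inverse f * f = 1" by (simp add: inverse_puiseux_def mult.commute)
qed (auto simp: divide_puiseux_def inverse_puiseux_def)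
end

instance puiseux :: ("{comm_ring_1,ring_char_0}") ring_char_0
proof
  have of_nat: "(of_nat n :: 'a puiseux) = puiseux_of_fls 1 (of_nat n)" for n
    by (induction n)
      (simp_all add: puiseux_of_fls_0 puiseux_of_fls_1[symmetric, of 1] puiseux_of_fls_add)
  have "fls_nth (of_nat n :: 'a fls) 0 = of_nat n" for n
    by (simp add: fls_of_nat_nth)
  then show "inj (of_nat :: nat \<Rightarrow> 'a puiseux)"
    by (intro injI) (metis of_nat of_nat_eq_iff puiseux_of_fls_inject zero_less_one)
qed

subsection \<open>Valuation\<close>

definition pval :: "'a::zero puiseux \<Rightarrow> rat extended" where
  "pval f = (if f = 0 then Pinf else Fin (LEAST r. pcoeff f r \<noteq> 0))"

lemma pval_of_fls:
  assumes "k > 0" "F \<noteq> 0"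
  shows "pval (puiseux_of_fls k F) = Fin (of_int (fls_subdegree F) / of_nat k)"
proof -
  have "puiseux_of_fls k F \<noteq> 0"
    using assms by (metis puiseux_of_fls_0 puiseux_of_fls_inject)
  moreover have "(LEAST r. puiseux_nth k F r \<noteq> 0) = of_int (fls_subdegree F) / of_nat k"
  proof (rule Least_equality)
    fix r assume r: "puiseux_nth k F r \<noteq> 0"
    then have "of_nat k * r \<in> \<int>" by (auto simp: puiseux_nth_def split: if_splits)
    then obtain n where n: "of_nat k * r = of_int n" by (elim Ints_cases)
    with r have "fls_subdegree F \<le> n" by (auto simp: puiseux_nth_def intro: fls_subdegree_leI)
    then have "of_int (fls_subdegree F) \<le> of_nat k * r" unfolding n by simp
    then show "of_int (fls_subdegree F) / of_nat k \<le> r"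
      using assms by (simp add: field_simps)
  qed (use assms in \<open>simp add: puiseux_nth_def\<close>)
  ultimately show ?thesis using assms by (simp add: pval_def pcoeff_of_fls)
qed

section \<open>Integrality exponents\<close>

text \<open>Polynomials \<open>q(X,Y) \<in> K[[X]][Y]\<close> are of type \<^typ>\<open>'k fps poly\<close>, with variable \<open>Y\<close>. An
  embedding \<open>\<iota>\<close> of \<open>K\<close> into \<open>L\<close> turns them into polynomials in \<open>Y\<close> over the Puiseux series
  over \<open>L\<close>.\<close>

definition puiseux_poly :: "('k::zero \<Rightarrow> 'l::zero) \<Rightarrow> 'k fps poly \<Rightarrow> 'l puiseux poly" where
  "puiseux_poly \<iota> =
     map_poly (\<lambda>c. puiseux_of_fls 1 (fps_to_fls (Abs_fps (\<lambda>n. \<iota> (fps_nth c n)))))"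

definition puiseux_expansions ::
    "('k::zero \<Rightarrow> 'l::comm_ring_1) \<Rightarrow> 'k fps poly \<Rightarrow> 'l puiseux set" where
  "puiseux_expansions \<iota> g = {\<gamma>. poly (puiseux_poly \<iota> g) \<gamma> = 0}"

definition valuation_at ::
    "('k::zero \<Rightarrow> 'l::comm_ring_1) \<Rightarrow> 'k fps poly \<Rightarrow> 'l puiseux poly \<Rightarrow> rat extended" where
  "valuation_at \<iota> g q = Min ((\<lambda>\<gamma>. pval (poly q \<gamma>)) ` puiseux_expansions \<iota> g)"

text \<open>Used only for \<open>q\<close> monic in \<open>Y\<close> of smaller degree than the square-free polynomial \<open>g\<close>, so
  that the valuation is finite; the value 0 in the other case is a dummy.\<close>

definition integrality_exponent ::
    "('k::zero \<Rightarrow> 'l::comm_ring_1) \<Rightarrow> 'k fps poly \<Rightarrow> 'k fps poly \<Rightarrow> int" where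
  "integrality_exponent \<iota> g q =
     (case valuation_at \<iota> g (puiseux_poly \<iota> q) of Fin r \<Rightarrow> \<lfloor>r\<rfloor> | _ \<Rightarrow> 0)"

definition max_integrality_exponent ::
    "('k::comm_ring_1 \<Rightarrow> 'l::comm_ring_1) \<Rightarrow> 'k fps poly \<Rightarrow> nat \<Rightarrow> int" where
  "max_integrality_exponent \<iota> g d =
     (GREATEST n. \<exists>q. lead_coeff q = 1 \<and> degree q = d \<and> n = integrality_exponent \<iota> g q)"

section \<open>Normalization and integral bases\<close>

definition integral_over :: "('a, 'b) ring_scheme \<Rightarrow> 'a set \<Rightarrow> 'a \<Rightarrow> bool" where
  "integral_over R A z \<longleftrightarrow> (\<exists>n>0. \<exists>c \<in> {..<n} \<rightarrow> A.
     z [^]\<^bsub>R\<^esub> (n::nat) \<oplus>\<^bsub>R\<^esub> (\<Oplus>\<^bsub>R\<^esub>i\<in>{..<n}. c i \<otimes>\<^bsub>R\<^esub> (z [^]\<^bsub>R\<^esub> i)) = \<zero>\<^bsub>R\<^esub>)"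

definition integral_closure :: "('a, 'b) ring_scheme \<Rightarrow> 'a set \<Rightarrow> 'a set" where
  "integral_closure R A = {z \<in> carrier R. integral_over R A z}"

text \<open>\<open>S\<close> is a finite set of free generators of the \<open>A\<close>-submodule \<open>M\<close> of \<open>R\<close>, where \<open>A\<close> is a
  subring of \<open>R\<close>.\<close>

definition free_generators ::
    "('a, 'b) ring_scheme \<Rightarrow> 'a set \<Rightarrow> 'a set \<Rightarrow> 'a set \<Rightarrow> bool" where
  "free_generators R A M S \<longleftrightarrow> finite S \<and> S \<subseteq> M \<and>
     (\<forall>z\<in>M. \<exists>!c. c \<in> S \<rightarrow>\<^sub>E A \<and> z = (\<Oplus>\<^bsub>R\<^esub>s\<in>S. c s \<otimes>\<^bsub>R\<^esub> s))"

text \<open>The total ring of fractions \<open>K((X))[Y]/\<langle>g\<rangle>\<close> of \<open>B = K[[X]][Y]/\<langle>g\<rangle>\<close>. Since \<open>g\<close> is monic,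
  \<open>B\<close> embeds into it; \<open>B\<close> and \<open>K[[x]]\<close> are taken to be the respective subrings.\<close>

definition laurent_poly :: "'k::zero fps poly \<Rightarrow> 'k fls poly" where
  "laurent_poly = map_poly fps_to_fls"

abbreviation fraction_ideal :: "'k::field fps poly \<Rightarrow> 'k fls poly set" where
  "fraction_ideal g \<equiv> PIdl\<^bsub>ring_of_type_algebra\<^esub> (laurent_poly g)"

definition fraction_ring :: "'k::field fps poly \<Rightarrow> 'k fls poly set ring" where
  "fraction_ring g = ring_of_type_algebra Quot fraction_ideal g"

definition residue :: "'k::field fps poly \<Rightarrow> 'k fls poly \<Rightarrow> 'k fls poly set" where
  "residue g f = fraction_ideal g +>\<^bsub>ring_of_type_algebra\<^esub> f"

definition base_ring :: "'k::field fps poly \<Rightarrow> 'k fls poly set set" where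
  "base_ring g = (\<lambda>c. residue g (laurent_poly [:c:])) ` UNIV"

definition coordinate_ring :: "'k::field fps poly \<Rightarrow> 'k fls poly set set" where
  "coordinate_ring g = (\<lambda>q. residue g (laurent_poly q)) ` UNIV"

definition normalization :: "'k::field fps poly \<Rightarrow> 'k fls poly set set" where
  "normalization g = integral_closure (fraction_ring g) (coordinate_ring g)"

definition integral_basis :: "'k::field fps poly \<Rightarrow> 'k fls poly set set \<Rightarrow> bool" where
  "integral_basis g S \<longleftrightarrow> free_generators (fraction_ring g) (base_ring g) (normalization g) S"

text \<open>\<open>x\<close> is a unit of the fraction ring, so this is \<open>p(x,y)/x\<^bsup>e\<^esup>\<close> also for negative \<open>e\<close>.\<close>

definition residue_fraction ::
    "'k::field fps poly \<Rightarrow> 'k fps poly \<Rightarrow> int \<Rightarrow> 'k fls poly set" where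
  "residue_fraction g p e = residue g (laurent_poly p) \<otimes>\<^bsub>fraction_ring g\<^esub>
     inv\<^bsub>fraction_ring g\<^esub> (residue g (laurent_poly [:fps_X:]) [^]\<^bsub>fraction_ring g\<^esub> e)"

end

theory Submission
  imports Defs
begin

text \<open>
  Write \<open>O = K[[X]]\<close>, \<open>F = K((X))\<close> and \<open>E = L{{X}}\<close>, and let \<open>\<gamma>\<close> range over the roots of \<open>g\<close> in
  \<open>E\<close>. Everything rests on one criterion: the class of \<open>f \<in> F[Y]\<close> modulo \<open>g\<close> lies in the
  normalization if and only if every \<open>f(\<gamma>)\<close> has valuation at least 0.

  Given the criterion, \<open>p/x\<^sup>e\<close> is integral exactly when the integrality exponent of \<open>p\<close> is at least
  \<open>e\<close>, and the rest is elimination along the degree in \<open>Y\<close>. If the proposed elements, of degrees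
  \<open>0, \<dots>, m-1\<close>, generate the normalization and \<open>q\<close> is monic of degree \<open>d\<close> with \<open>q/x\<^sup>n\<close> integral, then
  comparing leading coefficients in the expansion of \<open>q/x\<^sup>n\<close> gives \<open>n \<le> e\<^sub>d\<close>
  (\<open>spanning_imp_optimal\<close>). Conversely, if the exponents are maximal, the leading coefficient of an
  integral element of degree \<open>d\<close> has order at least \<open>-e\<^sub>d\<close>, so a multiple of
  \<open>p\<^sub>d/x\<^bsup>e(d)\<^esup>\<close> with coefficient in \<open>O\<close> cancels it and induction on the degree applies
  (\<open>optimal_imp_spanning\<close>). Freeness is automatic because the degrees are distinct.

  One point in the converse needs care: dividing an integral element by its leading coefficient gives a
  monic polynomial over \<open>F\<close>, whereas the maximal exponent only looks at polynomials over \<open>O\<close>.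
  If a monic polynomial has coefficients outside \<open>O\<close>, some of its roots have negative valuation;
  replacing those roots by 0 does not lower its valuation at the integral elements \<open>\<gamma>\<close>. The
  factor carrying the other roots is obtained over \<open>O\<close>, up to a high power of \<open>X\<close>, by an
  approximate Weierstrass preparation (\<open>integral_coefficients_suffice\<close>).

  The criterion itself uses that \<open>g\<close> splits over \<open>E\<close>, which is the theorem of Newton and Puiseux;
  it is derived from Hensel's lemma over \<open>L[[T]]\<close>. The roots are distinct because the minimal
  polynomial over \<open>F\<close> of a multiple root would divide \<open>g\<close> twice, and it has coefficients in
  \<open>O\<close>. An integral equation for \<open>f\<close> is then found by expanding \<open>\<Prod>(T - f(\<gamma>))\<close>. Its coefficients
  are integral, but they are only known to lie in \<open>E\<close>. An \<open>F\<close>-linear retraction of \<open>E\<close> onto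
  \<open>F\<close> that preserves integrality moves them to \<open>O\<close> and keeps the equation, since the
  equation is linear in them (\<open>integral_imp_equation\<close>). This avoids Galois theory and symmetric functions.
\<close>


section \<open>Polynomials under ring homomorphisms\<close>

locale unital_hom =
  fixes h :: "'a::comm_ring_1 \<Rightarrow> 'b::comm_ring_1"
  assumes hom_add: "h (x + y) = h x + h y"
    and hom_mult: "h (x * y) = h x * h y"
    and hom_one: "h 1 = 1"
begin

lemma hom_zero: "h 0 = 0"
  using hom_add[of 0 0] by simp

lemma hom_uminus: "h (- x) = - h x"
  using hom_add[of x "- x"] by (simp add: hom_zero eq_neg_iff_add_eq_0 add.commute)

lemma hom_diff: "h (x - y) = h x - h y"
  using hom_add[of x "- y"] by (simp add: hom_uminus)

lemma hom_sum: "h (sum f A) = (\<Sum>i\<in>A. h (f i))"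
  by (induction A rule: infinite_finite_induct) (simp_all add: hom_zero hom_add)

lemma hom_power: "h (x ^ n) = h x ^ n"
  by (induction n) (simp_all add: hom_one hom_mult)

lemma coeff_map: "coeff (map_poly h p) n = h (coeff p n)"
  by (simp add: coeff_map_poly hom_zero)

lemma map_poly_hom_add: "map_poly h (p + q) = map_poly h p + map_poly h q"
  by (rule poly_eqI) (simp add: coeff_map hom_add)

lemma map_poly_hom_mult: "map_poly h (p * q) = map_poly h p * map_poly h q"
  by (rule poly_eqI) (simp add: coeff_map hom_mult hom_sum coeff_mult)

lemma unital_hom_map_poly: "unital_hom (map_poly h)"
  by unfold_locales (simp_all add: map_poly_hom_add map_poly_hom_mult hom_one)

lemma map_poly_hom_smult: "map_poly h (smult c p) = smult (h c) (map_poly h p)"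
  by (rule poly_eqI) (simp add: coeff_map hom_mult)

lemma degree_map_poly_monic:
  assumes "lead_coeff p = 1"
  shows "degree (map_poly h p) = degree p" and "lead_coeff (map_poly h p) = 1"
proof -
  have c: "coeff (map_poly h p) (degree p) = 1"
    using assms by (simp add: coeff_map hom_one)
  show "degree (map_poly h p) = degree p"
  proof (rule antisym)
    show "degree (map_poly h p) \<le> degree p"
      by (rule degree_le) (simp add: coeff_map coeff_eq_0 hom_zero)
    show "degree p \<le> degree (map_poly h p)"
      by (rule le_degree) (simp add: c)
  qed
  with c show "lead_coeff (map_poly h p) = 1" by simp
qed

end

lemma coeff_linear_mult:
  fixes c :: "'a::comm_ring_1"
  shows "coeff ([:- c, 1:] * q) n = (case n of 0 \<Rightarrow> 0 | Suc k \<Rightarrow> coeff q k) - c * coeff q n"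
  by (auto simp: coeff_pCons split: nat.splits)

lemma poly_of_coeff_fun:
  fixes f :: "nat \<Rightarrow> 'a::comm_monoid_add"
  obtains p where "\<And>i. coeff p i = (if i \<le> n then f i else 0)"
proof
  fix i show "coeff (\<Sum>j\<le>n. monom (f j) j) i = (if i \<le> n then f i else 0)"
    by (simp add: coeff_sum)
qed

section \<open>Hensel's lemma over power series\<close>

text \<open>The identity expresses that \<open>(Y - c)\<^sup>k\<close> and \<open>b\<close> are coprime, with the degree bounds under which the
cofactors are unique. Subtracting a constant multiple of \<open>b\<close> makes \<open>R\<close> vanish at
\<open>c\<close>, so one factor \<open>Y - c\<close> can be split off and induction on \<open>k\<close> applies. Degree bounds are
stated through coefficients so that zero polynomials need no separate treatment.\<close>

lemma coprime_to_linear_power: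
  fixes b :: "'a::field poly"
  assumes "poly b c \<noteq> 0" and "\<And>i. i \<ge> k + degree b \<Longrightarrow> coeff R i = 0"
  shows "\<exists>A B. (\<forall>i\<ge>k. coeff A i = 0) \<and> (\<forall>i\<ge>degree b. coeff B i = 0) \<and>
    [:- c, 1:] ^ k * B + b * A = R"
  using assms(2)
proof (induction k arbitrary: R)
  case 0
  then show ?case by (intro exI[of _ 0] exI[of _ R]) auto
next
  case (Suc k)
  define t where "t = poly R c / poly b c"
  have "poly (R - smult t b) c = 0" using assms(1) by (simp add: t_def)
  then obtain R' where R': "R - smult t b = [:- c, 1:] * R'"
    using poly_eq_0_iff_dvd by (metis dvdE)
  have "coeff R' i = 0" if i: "i \<ge> k + degree b" for i
  proof (cases "R' = 0")
    case False
    have "coeff ([:- c, 1:] * R') (Suc (degree R')) = lead_coeff R'"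
      by (simp only: coeff_linear_mult) (simp add: coeff_eq_0)
    then have ne: "coeff (R - smult t b) (Suc (degree R')) \<noteq> 0"
      using False by (metis R' leading_coeff_0_iff)
    have "degree R' < k + degree b"
    proof (rule ccontr)
      assume "\<not> degree R' < k + degree b"
      then have "Suc (degree R') \<ge> Suc k + degree b" "Suc (degree R') > degree b" by auto
      with Suc.prems ne show False by (simp add: coeff_eq_0)
    qed
    with i show ?thesis by (simp add: coeff_eq_0)
  qed simp
  from Suc.IH[OF this] obtain A B where AB: "\<forall>i\<ge>k. coeff A i = 0"
    "\<forall>i\<ge>degree b. coeff B i = 0" "[:- c, 1:] ^ k * B + b * A = R'" by blast
  have "R = [:- c, 1:] * R' + smult t b" using R' by (simp add: algebra_simps)
  also have "\<dots> = [:- c, 1:] ^ Suc k * B + b * ([:t:] + [:- c, 1:] * A)"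
    by (simp only: AB(3)[symmetric] power_Suc) (simp add: algebra_simps)
  finally have "[:- c, 1:] ^ Suc k * B + b * ([:t:] + [:- c, 1:] * A) = R" ..
  moreover have "\<forall>i\<ge>Suc k. coeff ([:t:] + [:- c, 1:] * A) i = 0"
  proof (intro allI impI)
    fix i assume "i \<ge> Suc k"
    then show "coeff ([:t:] + [:- c, 1:] * A) i = 0"
      unfolding coeff_add coeff_linear_mult using AB(1)
      by (auto simp: coeff_pCons split: nat.splits)
  qed
  ultimately show ?case using AB(2) by blast
qed

lemma degree_less_coeff_mult:
  assumes "\<forall>i\<ge>a. coeff p i = 0" "\<forall>i\<ge>b. coeff q i = 0" "i \<ge> a + b"
  shows "coeff (p * q) i = (0::'a::comm_ring_1)"
  unfolding coeff_mult
proof (intro sum.neutral ballI)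
  fix j assume "j \<in> {..i}"
  then have "j \<ge> a \<or> i - j \<ge> b" using assms(3) by auto
  then show "coeff p j * coeff q (i - j) = 0" using assms by auto
qed

text \<open>The \<open>T\<^sup>n\<close>-coefficients of the two Hensel factors: comparing coefficients of \<open>T\<^sup>n\<close> in \<open>P = A B\<close> leaves
a linear equation for the \<open>n\<close>-th coefficients in terms of all earlier ones.\<close>

function hensel_factors ::
  "'a::field \<Rightarrow> nat \<Rightarrow> 'a poly \<Rightarrow> (nat \<Rightarrow> 'a poly) \<Rightarrow> nat \<Rightarrow> 'a poly \<times> 'a poly" where
  "hensel_factors c k b P n = (if n = 0 then ([:- c, 1:] ^ k, b) else
     (SOME (A, B). (\<forall>i\<ge>k. coeff A i = 0) \<and> (\<forall>i\<ge>degree b. coeff B i = 0) \<and>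
        [:- c, 1:] ^ k * B + b * A = P n -
          (\<Sum>i\<in>{1..<n}. fst (hensel_factors c k b P i) * snd (hensel_factors c k b P (n - i)))))"
  by auto
termination by (relation "measure (\<lambda>(c, k, b, P, n). n)") auto

declare hensel_factors.simps [simp del]

lemma hensel_factors_step:
  fixes c :: "'a::field"
  assumes b: "poly b c \<noteq> 0"
    and P: "\<And>n i. n > 0 \<Longrightarrow> i \<ge> k + degree b \<Longrightarrow> coeff (P n) i = 0"
  defines "A \<equiv> \<lambda>n. fst (hensel_factors c k b P n)" and "B \<equiv> \<lambda>n. snd (hensel_factors c k b P n)"
  assumes "n > 0"
  shows "(\<forall>i\<ge>k. coeff (A n) i = 0) \<and> (\<forall>i\<ge>degree b. coeff (B n) i = 0) \<and>
    [:- c, 1:] ^ k * B n + b * A n = P n - (\<Sum>i\<in>{1..<n}. A i * B (n - i))"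
  using assms(5)
proof (induction n rule: less_induct)
  case (less n)
  define R where "R = P n - (\<Sum>i\<in>{1..<n}. A i * B (n - i))"
  have "coeff (A i * B (n - i)) j = 0" if "i \<in> {1..<n}" "j \<ge> k + degree b" for i j
    by (rule degree_less_coeff_mult[OF _ _ that(2)]) (use less.IH that(1) in auto)
  then have "coeff R j = 0" if "j \<ge> k + degree b" for j
    using that P less.prems by (simp add: R_def coeff_sum)
  from coprime_to_linear_power[where k = k, OF b this]
  obtain A' B' where "(\<lambda>(A, B). (\<forall>i\<ge>k. coeff A i = 0) \<and> (\<forall>i\<ge>degree b. coeff B i = 0) \<and>
        [:- c, 1:] ^ k * B + b * A = R) (A', B')" by auto
  from someI[of "\<lambda>(A, B). (\<forall>i\<ge>k. coeff A i = 0) \<and> (\<forall>i\<ge>degree b. coeff B i = 0) \<and>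
        [:- c, 1:] ^ k * B + b * A = R", OF this]
  have "(\<lambda>(A, B). (\<forall>i\<ge>k. coeff A i = 0) \<and> (\<forall>i\<ge>degree b. coeff B i = 0) \<and>
        [:- c, 1:] ^ k * B + b * A = R) (hensel_factors c k b P n)"
    unfolding hensel_factors.simps[of c k b P n] using less.prems
    by (simp add: R_def A_def B_def)
  then show ?case by (simp add: R_def A_def B_def case_prod_beta)
qed

text \<open>Over an algebraically closed residue field every reduction has such a factorization, with \<open>c\<close> one of
its roots and \<open>k\<close> the multiplicity. The factors are assembled from the coefficientwise solution;
the \<open>T\<^sup>n\<close>-coefficients of \<open>A\<close> have degree below \<open>k\<close> for \<open>n > 0\<close>, which keeps \<open>A\<close> monic.\<close>

lemma hensel_linear_power:
  fixes P :: "'a::field fps poly"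
  assumes monic: "lead_coeff P = 1"
    and red: "map_poly (\<lambda>f. fps_nth f 0) P = [:- c, 1:] ^ k * b" and b: "poly b c \<noteq> 0"
  obtains A B where "P = A * B" "lead_coeff A = 1" "degree A = k"
proof -
  define P' where "P' = (\<lambda>j. map_poly (\<lambda>f. fps_nth f j) P)"
  have cP': "coeff (P' j) i = fps_nth (coeff P i) j" for i j
    by (simp add: P'_def coeff_map_poly)
  interpret r: unital_hom "\<lambda>f::'a fps. fps_nth f 0" by unfold_locales simp_all
  have b0: "b \<noteq> 0" using b by auto
  have deg: "degree P = k + degree b"
    using r.degree_map_poly_monic(1)[OF monic] b0 unfolding red
    by (simp add: degree_mult_eq degree_linear_power)
  have P0: "coeff (P' n) i = 0" if "n > 0" "i \<ge> k + degree b" for n i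
  proof (cases "i = degree P")
    case True
    with monic that show ?thesis by (simp add: cP')
  next
    case False
    with deg that have "i > degree P" by simp
    then show ?thesis by (simp add: cP' coeff_eq_0)
  qed
  define AB where "AB = hensel_factors c k b P'"
  note step = hensel_factors_step[where P = P' and k = k, OF b P0, folded AB_def]
  have AB0: "AB 0 = ([:- c, 1:] ^ k, b)" by (simp add: AB_def hensel_factors.simps)
  have degA: "coeff (fst (AB n)) i = 0" if "i > k" for n i
    using that step[of n] AB0 by (cases "n = 0") (auto simp: coeff_eq_0 degree_linear_power)
  have degB: "coeff (snd (AB n)) i = 0" if "i > degree b" for n i
    using that step[of n] AB0 by (cases "n = 0") (auto simp: coeff_eq_0)
  have conv: "(\<Sum>i\<le>n. fst (AB i) * snd (AB (n - i))) = P' n" for n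
  proof (cases "n = 0")
    case True
    then show ?thesis by (simp add: AB0 red P'_def)
  next
    case False
    have "{..n} = insert 0 (insert n {1..<n})" using False by auto
    then have "(\<Sum>i\<le>n. fst (AB i) * snd (AB (n - i))) =
        fst (AB 0) * snd (AB n) + fst (AB n) * snd (AB 0) +
        (\<Sum>i\<in>{1..<n}. fst (AB i) * snd (AB (n - i)))"
      using False by (simp add: add.assoc)
    also have "\<dots> = P' n" using step[of n] False by (simp add: AB0 mult.commute)
    finally show ?thesis .
  qed
  obtain A where A: "\<And>i. coeff A i = (if i \<le> k then Abs_fps (\<lambda>n. coeff (fst (AB n)) i) else 0)"
    using poly_of_coeff_fun[of k "\<lambda>i. Abs_fps (\<lambda>n. coeff (fst (AB n)) i)"] by blast
  obtain B where B: "\<And>i. coeff B i = (if i \<le> degree b then Abs_fps (\<lambda>n. coeff (snd (AB n)) i) else 0)"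
    using poly_of_coeff_fun[of "degree b" "\<lambda>i. Abs_fps (\<lambda>n. coeff (snd (AB n)) i)"] by blast
  have A': "fps_nth (coeff A i) n = coeff (fst (AB n)) i" for i n using degA by (simp add: A)
  have B': "fps_nth (coeff B i) n = coeff (snd (AB n)) i" for i n using degB by (simp add: B)
  have "A * B = P"
  proof (intro poly_eqI fps_ext)
    fix i n
    have "fps_nth (coeff (A * B) i) n =
        (\<Sum>j\<le>i. \<Sum>l\<le>n. coeff (fst (AB l)) j * coeff (snd (AB (n - l))) (i - j))"
      by (simp add: coeff_mult fps_sum_nth fps_mult_nth A' B' atMost_atLeast0)
    also have "\<dots> = coeff (\<Sum>l\<le>n. fst (AB l) * snd (AB (n - l))) i"
      by (subst sum.swap) (simp add: coeff_sum coeff_mult)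
    also have "\<dots> = fps_nth (coeff P i) n" by (simp add: conv cP')
    finally show "fps_nth (coeff (A * B) i) n = fps_nth (coeff P i) n" .
  qed
  moreover have "coeff A k = 1"
  proof (rule fps_ext)
    fix n
    show "fps_nth (coeff A k) n = fps_nth 1 n"
      using step[of n] AB0 by (cases "n = 0") (simp_all add: A' coeff_linear_power)
  qed
  moreover from this have "degree A = k"
    by (intro antisym degree_le le_degree) (auto simp: A)
  ultimately show ?thesis using that[of A B] by simp
qed


section \<open>The valuation of Puiseux series\<close>

lemma pcoeff_zero [simp]: "pcoeff 0 r = (0::'a::comm_ring_1)"
proof -
  have "pcoeff (puiseux_of_fls 1 (0::'a fls)) r = 0"
    by (simp only: pcoeff_of_fls zero_less_one) (simp add: puiseux_nth_def)
  then show ?thesis by (simp add: puiseux_of_fls_0)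
qed

lemma pcoeff_one: "pcoeff 1 r = (if r = 0 then 1 else (0::'a::comm_ring_1))"
proof -
  have "pcoeff (puiseux_of_fls 1 (1::'a fls)) r = (if r = 0 then 1 else 0)"
    by (simp only: pcoeff_of_fls zero_less_one) (auto simp: puiseux_nth_def elim!: Ints_cases)
  then show ?thesis by (simp add: puiseux_of_fls_1)
qed

lemma pcoeff_add [simp]: "pcoeff (f + g) r = pcoeff f r + pcoeff g (r::rat)"
  for f g :: "'a::comm_ring_1 puiseux"
proof -
  obtain k F G where "k > 0" "f = puiseux_of_fls k F" "g = puiseux_of_fls k G"
    by (rule puiseux_cases2)
  then show ?thesis by (simp add: puiseux_of_fls_add pcoeff_of_fls puiseux_nth_def)
qed

lemma pcoeff_diff [simp]: "pcoeff (f - g) r = pcoeff f r - pcoeff g (r::rat)"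
  for f g :: "'a::comm_ring_1 puiseux"
  by (metis add_diff_cancel_right' diff_add_cancel pcoeff_add)

lemma pcoeff_mult:
  fixes f g :: "'a::comm_ring_1 puiseux"
  shows "pcoeff (f * g) r =
    (\<Sum>s | pcoeff f s \<noteq> 0 \<and> pcoeff g (r - s) \<noteq> 0. pcoeff f s * pcoeff g (r - s))"
proof -
  obtain k F G where "k > 0" "f = puiseux_of_fls k F" "g = puiseux_of_fls k G"
    by (rule puiseux_cases2)
  then show ?thesis by (simp add: puiseux_of_fls_mult pcoeff_of_fls puiseux_nth_convolution)
qed

text \<open>A lower bound for the valuation. In this form the bound makes sense for 0 as well, and sums and products
can be estimated without arithmetic on values extended by infinity.\<close>

definition val_ge :: "rat \<Rightarrow> 'a::zero puiseux \<Rightarrow> bool" where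
  "val_ge r f \<longleftrightarrow> (\<forall>s<r. pcoeff f s = 0)"

lemma val_ge_0 [simp]: "val_ge r (0::'a::comm_ring_1 puiseux)"
  by (simp add: val_ge_def)

lemma val_ge_1: "r \<le> 0 \<Longrightarrow> val_ge r (1::'a::comm_ring_1 puiseux)"
  by (simp add: val_ge_def pcoeff_one)

lemma val_ge_add: "val_ge r f \<Longrightarrow> val_ge r g \<Longrightarrow> val_ge r (f + g)"
  for f g :: "'a::comm_ring_1 puiseux"
  by (simp add: val_ge_def)

lemma val_ge_diff: "val_ge r f \<Longrightarrow> val_ge r g \<Longrightarrow> val_ge r (f - g)"
  for f g :: "'a::comm_ring_1 puiseux"
  by (simp add: val_ge_def)

lemma val_ge_uminus: "val_ge r f \<Longrightarrow> val_ge r (- f)"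
  for f :: "'a::comm_ring_1 puiseux"
  using val_ge_diff[of r 0 f] by simp

lemma val_ge_mono: "val_ge r f \<Longrightarrow> s \<le> r \<Longrightarrow> val_ge s f"
  by (simp add: val_ge_def)

lemma val_ge_mult:
  fixes f g :: "'a::comm_ring_1 puiseux"
  assumes "val_ge r f" "val_ge s g"
  shows "val_ge (r + s) (f * g)"
  unfolding val_ge_def
proof (intro allI impI)
  fix t assume t: "t < r + s"
  have "{u. pcoeff f u \<noteq> 0 \<and> pcoeff g (t - u) \<noteq> 0} = {}"
  proof (rule ccontr)
    assume "{u. pcoeff f u \<noteq> 0 \<and> pcoeff g (t - u) \<noteq> 0} \<noteq> {}"
    then obtain u where "pcoeff f u \<noteq> 0" "pcoeff g (t - u) \<noteq> 0" by blast
    with assms have "\<not> u < r" "\<not> t - u < s" by (auto simp: val_ge_def)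
    with t show False by linarith
  qed
  then show "pcoeff (f * g) t = 0" by (simp only: pcoeff_mult sum.empty)
qed

lemma val_ge_mult':
  fixes f g :: "'a::comm_ring_1 puiseux"
  shows "val_ge r f \<Longrightarrow> val_ge s g \<Longrightarrow> t = r + s \<Longrightarrow> val_ge t (f * g)"
  using val_ge_mult by blast

lemma val_ge_mult0: "val_ge 0 f \<Longrightarrow> val_ge r g \<Longrightarrow> val_ge r (f * g)"
  for f g :: "'a::comm_ring_1 puiseux"
  using val_ge_mult[of 0 f r g] by simp

text \<open>The lowest terms multiply without interference: every other pair of exponents with the same sum has one
exponent below its bound. This is what makes the valuation multiplicative.\<close>

lemma pcoeff_mult_lowest:
  fixes f g :: "'a::comm_ring_1 puiseux"
  assumes "val_ge r f" "val_ge s g"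
  shows "pcoeff (f * g) (r + s) = pcoeff f r * pcoeff g s"
proof -
  let ?S = "{u. pcoeff f u \<noteq> 0 \<and> pcoeff g (r + s - u) \<noteq> 0}"
  have "?S \<subseteq> {r}"
  proof
    fix u assume u: "u \<in> ?S"
    with assms have "\<not> u < r" "\<not> r + s - u < s" by (auto simp: val_ge_def)
    then show "u \<in> {r}" by simp
  qed
  then have "(\<Sum>u\<in>?S. pcoeff f u * pcoeff g (r + s - u)) =
      (\<Sum>u\<in>{r}. pcoeff f u * pcoeff g (r + s - u))"
    by (intro sum.mono_neutral_left) auto
  then show ?thesis by (simp add: pcoeff_mult)
qed

lemma val_ge_sum: "(\<And>i. i \<in> A \<Longrightarrow> val_ge r (f i)) \<Longrightarrow> val_ge r (\<Sum>i\<in>A. f i)"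
  for f :: "_ \<Rightarrow> 'a::comm_ring_1 puiseux"
  by (induction A rule: infinite_finite_induct) (auto intro: val_ge_add)

lemma val_ge_power: "val_ge r f \<Longrightarrow> val_ge (of_nat n * r) (f ^ n)"
  for f :: "'a::comm_ring_1 puiseux"
proof (induction n)
  case (Suc n)
  then show ?case by (auto intro!: val_ge_mult'[of r f] simp: algebra_simps)
qed (simp add: val_ge_1)

lemma val_ge_power0: "val_ge 0 f \<Longrightarrow> val_ge 0 (f ^ n)"
  for f :: "'a::comm_ring_1 puiseux"
  using val_ge_power[of 0 f n] by simp

lemma val_ge_poly:
  fixes p :: "'a::comm_ring_1 puiseux poly"
  assumes "\<And>i. val_ge 0 (coeff p i)" "val_ge 0 x"
  shows "val_ge 0 (poly p x)"
  unfolding poly_altdef by (intro val_ge_sum val_ge_mult0 assms val_ge_power0)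

lemma pcoeff_lowest_ex:
  fixes f :: "'a::comm_ring_1 puiseux"
  assumes "f \<noteq> 0"
  obtains r where "val_ge r f" "pcoeff f r \<noteq> 0" "pval f = Fin r"
proof -
  obtain k F where f: "k > 0" "f = puiseux_of_fls k F" by (rule puiseux_cases)
  with assms have F: "F \<noteq> 0" by (auto simp: puiseux_of_fls_0)
  define r where "r = (of_int (fls_subdegree F) / of_nat k :: rat)"
  have kr: "of_nat k * r = of_int (fls_subdegree F)" using f(1) by (simp add: r_def)
  have "pcoeff f r \<noteq> 0"
    using F f by (simp add: pcoeff_of_fls puiseux_nth_def kr)
  moreover have "val_ge r f"
    unfolding val_ge_def
  proof (intro allI impI)
    fix s assume "s < r"
    then have "of_nat k * s < of_int (fls_subdegree F)" using f(1) kr by (metis mult_strict_left_mono of_nat_0_less_iff)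
    then have "\<lfloor>of_nat k * s\<rfloor> < fls_subdegree F" by (simp add: floor_less_iff)
    then show "pcoeff f s = 0" by (simp add: f pcoeff_of_fls puiseux_nth_def)
  qed
  ultimately show ?thesis using that f F by (simp add: pval_of_fls r_def)
qed

lemma val_ge_ex: "\<exists>r\<le>0. val_ge r (f :: 'a::comm_ring_1 puiseux)"
proof (cases "f = 0")
  case False
  then obtain r where "val_ge r f" by (rule pcoeff_lowest_ex)
  then have "val_ge (min r 0) f" by (rule val_ge_mono) simp
  then show ?thesis by (intro exI[of _ "min r 0"]) simp
qed auto

lemma val_ge_pval: "val_ge r f \<longleftrightarrow> Fin r \<le> pval (f :: 'a::comm_ring_1 puiseux)"
proof (cases "f = 0")
  case False
  then obtain s where s: "val_ge s f" "pcoeff f s \<noteq> 0" "pval f = Fin s"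
    by (rule pcoeff_lowest_ex)
  then show ?thesis by (auto simp: val_ge_def not_less dest: leI)
qed (simp add: pval_def)

text \<open>\<open>X\<^sup>r\<close> for rational \<open>r\<close>, as needed for the substitution \<open>Y \<mapsto> X\<^sup>r Y\<close> in Newton's method.\<close>

definition puiseux_monom :: "rat \<Rightarrow> 'a::{zero,one} puiseux" where
  "puiseux_monom r = Abs_puiseux (\<lambda>s. if s = r then 1 else 0)"

lemma pcoeff_puiseux_monom: "pcoeff (puiseux_monom r) s = (if s = r then 1 else (0::'a::comm_ring_1))"
proof -
  obtain a b where ab: "quotient_of r = (a, b)" by force
  then have b: "b > 0" by (rule quotient_of_denom_pos)
  have r: "r = of_int a / of_int b" by (rule quotient_of_div[OF ab])
  define F :: "'a fls" where "F = fls_shift (- a) 1"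
  have ints: "of_nat (nat b) * s = of_int a \<longleftrightarrow> s = r" for s :: rat
  proof -
    have "(of_int b :: rat) \<noteq> 0" using b by simp
    then have "of_int a = of_int b * r" using r by simp
    then show ?thesis using b by simp
  qed
  have "puiseux_nth (nat b) F s = (if s = r then 1 else 0)" for s
  proof (cases "of_nat (nat b) * s \<in> \<int>")
    case True
    then obtain n where n: "of_nat (nat b) * s = of_int n" by (elim Ints_cases)
    then have "s = r \<longleftrightarrow> n = a" using ints[of s] by simp
    with n show ?thesis by (simp add: puiseux_nth_def F_def)
  next
    case False
    then have "s \<noteq> r" using ints[of s] by (metis Ints_of_int)
    with False show ?thesis by (simp add: puiseux_nth_def)
  qed
  then have "(\<lambda>s. if s = r then 1 else (0::'a)) = puiseux_nth (nat b) F" by (simp add: fun_eq_iff)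
  moreover have "pcoeff (puiseux_of_fls (nat b) F) = puiseux_nth (nat b) F"
    using b by (intro pcoeff_of_fls) simp
  ultimately show ?thesis
    by (simp add: puiseux_monom_def puiseux_of_fls_def fun_eq_iff[symmetric]) (metis (mono_tags))
qed

lemma pcoeff_monom_mult: "pcoeff (puiseux_monom r * f) s = pcoeff f (s - r)"
  for f :: "'a::comm_ring_1 puiseux"
proof -
  have "(\<Sum>u | pcoeff (puiseux_monom r :: 'a puiseux) u \<noteq> 0 \<and> pcoeff f (s - u) \<noteq> 0.
      pcoeff (puiseux_monom r) u * pcoeff f (s - u)) =
    (\<Sum>u\<in>{r}. pcoeff (puiseux_monom r) u * pcoeff f (s - u))"
    by (rule sum.mono_neutral_left) (auto simp: pcoeff_puiseux_monom split: if_splits)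
  then show ?thesis by (simp add: pcoeff_mult pcoeff_puiseux_monom)
qed

lemma puiseux_monom_add: "puiseux_monom (r + s) = (puiseux_monom r * puiseux_monom s :: 'a::comm_ring_1 puiseux)"
  by (rule puiseux_eqI) (simp add: pcoeff_monom_mult pcoeff_puiseux_monom algebra_simps)

lemma puiseux_monom_0: "puiseux_monom 0 = (1 :: 'a::comm_ring_1 puiseux)"
  by (rule puiseux_eqI) (simp add: pcoeff_puiseux_monom pcoeff_one)

lemma puiseux_monom_power: "puiseux_monom r ^ n = (puiseux_monom (of_nat n * r) :: 'a::comm_ring_1 puiseux)"
  by (induction n) (simp_all add: puiseux_monom_0 puiseux_monom_add algebra_simps)

lemma val_ge_puiseux_monom: "val_ge r (puiseux_monom r :: 'a::comm_ring_1 puiseux)"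
  by (simp add: val_ge_def pcoeff_puiseux_monom)

lemma val_ge_monom_mult: "val_ge s (puiseux_monom r * f) \<longleftrightarrow> val_ge (s - r) f"
  for f :: "'a::comm_ring_1 puiseux"
proof
  assume *: "val_ge s (puiseux_monom r * f)"
  show "val_ge (s - r) f"
    unfolding val_ge_def
  proof (intro allI impI)
    fix t assume "t < s - r"
    with * show "pcoeff f t = 0"
      unfolding val_ge_def pcoeff_monom_mult by (auto dest: spec[of _ "t + r"])
  qed
qed (simp add: val_ge_def pcoeff_monom_mult)

section \<open>The Newton--Puiseux theorem\<close>

lemma fps_to_fls_hom: "unital_hom (fps_to_fls :: 'a::comm_ring_1 fps \<Rightarrow> 'a fls)"
  by unfold_locales (simp_all add: fls_times_fps_to_fls)

lemma puiseux_of_fps_hom: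
  "k > 0 \<Longrightarrow> unital_hom (\<lambda>c :: 'a::comm_ring_1 fps. puiseux_of_fls k (fps_to_fls c))"
  by unfold_locales
    (simp_all add: fls_times_fps_to_fls puiseux_of_fls_add puiseux_of_fls_mult puiseux_of_fls_1)

lemma puiseux_common_denominator:
  fixes f :: "nat \<Rightarrow> 'a::comm_ring_1 puiseux"
  shows "\<exists>k>0. \<forall>i<n. \<exists>F. f i = puiseux_of_fls k F"
proof (induction n)
  case (Suc n)
  then obtain k where k: "k > 0" "\<And>i. i < n \<Longrightarrow> \<exists>F. f i = puiseux_of_fls k F" by blast
  obtain l G where l: "l > 0" "f n = puiseux_of_fls l G" by (rule puiseux_cases)
  have "\<exists>F. f i = puiseux_of_fls (k * l) F" if "i < Suc n" for i
  proof (cases "i = n")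
    case True
    then show ?thesis using puiseux_of_fls_refine[OF l(1) k(1), of G] l(2) by (simp add: mult.commute)
  next
    case False
    with that k(2) obtain F where "f i = puiseux_of_fls k F" by (metis less_SucE)
    then show ?thesis using puiseux_of_fls_refine[OF k(1) l(1), of F] by simp
  qed
  with k(1) l(1) show ?case by (intro exI[of _ "k * l"]) simp
qed auto

lemma puiseux_of_fps_if_val_ge_0:
  fixes F :: "'a::comm_ring_1 fls"
  assumes "k > 0" "val_ge 0 (puiseux_of_fls k F)"
  shows "F = fps_to_fls (fls_regpart F)"
proof (rule fls_eqI)
  fix n :: int
  show "fls_nth F n = fls_nth (fps_to_fls (fls_regpart F)) n"
  proof (cases "n < 0")
    case True
    then have "(of_int n / of_nat k :: rat) < 0" using assms(1) by (simp add: divide_less_0_iff)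
    then have "pcoeff (puiseux_of_fls k F) (of_int n / of_nat k) = 0"
      using assms(2) by (simp add: val_ge_def)
    then have "fls_nth F n = 0" using assms(1) by (simp add: pcoeff_of_fls puiseux_nth_def)
    with True show ?thesis by simp
  qed simp
qed

text \<open>Finitely many Puiseux series have a common denominator \<open>k\<close>, so a polynomial with integral
coefficients is one over \<open>L[[T]]\<close> with \<open>T = X\<^bsup>1/k\<^esup>\<close>. This is what gives access to Hensel's lemma.\<close>

lemma puiseux_poly_from_fps_poly:
  fixes P :: "'a::comm_ring_1 puiseux poly"
  assumes "\<And>i. val_ge 0 (coeff P i)"
  obtains k Q where "k > 0" "P = map_poly (\<lambda>c. puiseux_of_fls k (fps_to_fls c)) Q"
    "degree Q = degree P"
proof -
  obtain k where k: "k > 0" "\<And>i. i < Suc (degree P) \<Longrightarrow> \<exists>F. coeff P i = puiseux_of_fls k F"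
    using puiseux_common_denominator[of "Suc (degree P)" "coeff P"] by blast
  have "\<exists>c. coeff P i = puiseux_of_fls k (fps_to_fls c)" if "i \<le> degree P" for i
    using k(2)[of i] that puiseux_of_fps_if_val_ge_0[OF k(1)] assms[of i]
    by (metis less_Suc_eq_le)
  then obtain c where c: "\<And>i. i \<le> degree P \<Longrightarrow> coeff P i = puiseux_of_fls k (fps_to_fls (c i))"
    by metis
  obtain Q where Q: "\<And>i. coeff Q i = (if i \<le> degree P then c i else 0)"
    using poly_of_coeff_fun[of "degree P" c] by blast
  have eq: "P = map_poly (\<lambda>c. puiseux_of_fls k (fps_to_fls c)) Q"
    by (rule poly_eqI) (simp add: coeff_map_poly puiseux_of_fls_0 Q c coeff_eq_0)
  have "degree Q = degree P"
  proof (rule antisym)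
    show "degree Q \<le> degree P" by (rule degree_le) (simp add: Q)
    show "degree P \<le> degree Q" unfolding eq
      by (rule degree_le) (simp add: coeff_map_poly puiseux_of_fls_0 coeff_eq_0)
  qed
  with k(1) eq that show ?thesis by blast
qed

text \<open>The effect of the substitution \<open>Y \<mapsto> Y - c\<close> on the two top coefficients; it is used to depress a
polynomial and to show that \<open>(Y - c)\<^sup>n\<close> is not depressed in
characteristic zero unless \<open>c = 0\<close>.\<close>

lemma coeff_shift_top:
  fixes P :: "'a::comm_ring_1 poly"
  assumes "\<And>i. i > Suc n \<Longrightarrow> coeff P i = 0"
  shows "coeff (pcompose P [:- c, 1:]) (Suc n) = coeff P (Suc n)"
    and "coeff (pcompose P [:- c, 1:]) n = coeff P n - of_nat (Suc n) * c * coeff P (Suc n)"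
proof -
  have "coeff (pcompose P [:- c, 1:]) (Suc n) = coeff P (Suc n) \<and>
    coeff (pcompose P [:- c, 1:]) n = coeff P n - of_nat (Suc n) * c * coeff P (Suc n)"
    using assms
  proof (induction n arbitrary: P)
    case 0
    then have "P = [:coeff P 0, coeff P 1:]"
      by (intro poly_eqI) (auto simp: coeff_pCons split: nat.splits)
    then obtain a b where "P = [:a, b:]" by blast
    then show ?case by (simp add: pcompose_pCons algebra_simps)
  next
    case (Suc n)
    obtain a Q where P: "P = pCons a Q" by (rule pCons_cases)
    have Q: "coeff Q i = 0" if "i > Suc n" for i using Suc.prems[of "Suc i"] that by (simp add: P)
    note IH = Suc.IH[OF Q]
    have "coeff (pcompose Q [:- c, 1:]) (Suc (Suc n)) = 0"
    proof (rule coeff_eq_0)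
      have "degree Q \<le> Suc n" by (rule degree_le) (use Q in auto)
      then have "degree Q * degree [:- c, 1:] \<le> Suc n" by simp
      then show "degree (pcompose Q [:- c, 1:]) < Suc (Suc n)"
        using degree_pcompose_le[of Q "[:- c, 1:]"] by linarith
    qed
    then show ?case using IH
      unfolding P pcompose_pCons coeff_add coeff_linear_mult
      by (simp add: algebra_simps)
  qed
  then show "coeff (pcompose P [:- c, 1:]) (Suc n) = coeff P (Suc n)"
    and "coeff (pcompose P [:- c, 1:]) n = coeff P n - of_nat (Suc n) * c * coeff P (Suc n)" by auto
qed

lemma coeff_linear_power_subleading:
  fixes c :: "'a::comm_ring_1"
  shows "coeff ([:- c, 1:] ^ Suc n) n = - (of_nat (Suc n) * c)"
proof -
  have "pcompose (monom 1 (Suc n)) [:- c, 1:] = [:- c, 1:] ^ Suc n"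
    by (induction n) (simp_all add: monom_Suc pcompose_pCons monom_0)
  then show ?thesis using coeff_shift_top(2)[of n "monom 1 (Suc n)" c] by simp
qed

text \<open>Modulo positive powers of \<open>X\<close> the polynomial is monic, has no \<open>Y\<^sup>n\<close>-term and differs from
\<open>Y\<^bsup>n+1\<^esup>\<close>. In characteristic zero it is then not a power of a linear polynomial, so a root
\<open>c\<close> of the reduction has multiplicity \<open>l \<le> n\<close>, and Hensel's lemma lifts \<open>(Y - c)\<^sup>l\<close> to a proper
factor.\<close>

lemma newton_puiseux_proper_factor:
  fixes R :: "'l::{alg_closed_field, field_char_0} puiseux poly"
  assumes deg: "degree R = Suc n" and monic: "lead_coeff R = 1"
    and val: "\<And>i. val_ge 0 (coeff R i)" and sub: "coeff R n = 0"
    and i: "i < Suc n" "pcoeff (coeff R i) 0 \<noteq> 0"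
  obtains A where "A dvd R" "degree A < degree R" "degree A > 0" "lead_coeff A = 1"
proof -
  obtain k Q where k: "k > 0" and R: "R = map_poly (\<lambda>c. puiseux_of_fls k (fps_to_fls c)) Q"
    and degQ: "degree Q = degree R" by (rule puiseux_poly_from_fps_poly[OF val])
  interpret e: unital_hom "\<lambda>c :: 'l fps. puiseux_of_fls k (fps_to_fls c)"
    by (rule puiseux_of_fps_hom[OF k])
  interpret r: unital_hom "\<lambda>f::'l fps. fps_nth f 0" by unfold_locales simp_all
  have pc: "pcoeff (coeff R j) 0 = fps_nth (coeff Q j) 0" for j
    by (simp add: R e.coeff_map pcoeff_of_fls[OF k] puiseux_nth_def)
  have inj: "x = 1" if "puiseux_of_fls k (fps_to_fls x) = 1" for x :: "'l fps"
    using that puiseux_of_fls_inject[OF k] by (metis puiseux_of_fls_1[OF k] fps_to_fls_eq_1_iff)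
  have monicQ: "lead_coeff Q = 1"
    by (rule inj) (use monic degQ in \<open>simp add: R e.coeff_map\<close>)
  define Q0 where "Q0 = map_poly (\<lambda>f. fps_nth f 0) Q"
  have Q0: "degree Q0 = Suc n" "lead_coeff Q0 = 1"
    using r.degree_map_poly_monic[OF monicQ] deg degQ by (simp_all add: Q0_def)
  have cQ0: "coeff Q0 j = pcoeff (coeff R j) 0" for j by (simp add: Q0_def r.coeff_map pc)
  obtain c where c: "poly Q0 c = 0" using alg_closed_imp_poly_has_root[of Q0] Q0 by auto
  have Q0ne: "Q0 \<noteq> 0" using Q0 by auto
  define l where "l = order c Q0"
  obtain b where b: "Q0 = [:- c, 1:] ^ l * b" "\<not> [:- c, 1:] dvd b"
    using order_decomp[OF Q0ne, of c] unfolding l_def by blast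
  have bc: "poly b c \<noteq> 0" using b(2) poly_eq_0_iff_dvd by blast
  have l0: "l > 0" using c Q0ne order_root[of Q0 c] by (simp add: l_def)
  have "b \<noteq> 0" using bc by auto
  then have degs: "Suc n = l + degree b" using Q0(1) b(1) by (simp add: degree_mult_eq degree_linear_power)
  have "l \<noteq> Suc n"
  proof
    assume l: "l = Suc n"
    with degs have "degree b = 0" by simp
    then obtain b' where b': "b = [:b':]" by (rule degree_eq_zeroE)
    have "lead_coeff Q0 = lead_coeff ([:- c, 1:] ^ l) * lead_coeff b"
      unfolding b(1) by (rule lead_coeff_mult)
    then have "b' = 1" using Q0(2) b' by (simp add: lead_coeff_power)
    then have Q0eq: "Q0 = [:- c, 1:] ^ Suc n" using b(1) b' l by simp
    then have "of_nat (Suc n) * c = 0"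
      using coeff_linear_power_subleading[of c n] cQ0[of n] sub by simp
    then have "c = 0" by (metis mult_eq_0_iff of_nat_eq_0_iff nat.distinct(1))
    then have "Q0 = monom 1 (Suc n)" using Q0eq by (simp add: monom_altdef)
    then show False using i cQ0[of i] by simp
  qed
  with degs have l: "l < Suc n" by simp
  obtain A B where AB: "Q = A * B" "lead_coeff A = 1" "degree A = l"
    by (rule hensel_linear_power[OF monicQ b(1)[unfolded Q0_def] bc])
  let ?A = "map_poly (\<lambda>c. puiseux_of_fls k (fps_to_fls c)) A"
  show ?thesis
  proof (rule that[of ?A])
    show "?A dvd R" unfolding R AB(1) e.map_poly_hom_mult by simp
  qed (use e.degree_map_poly_monic[OF AB(2)] AB(3) l l0 deg in auto)
qed

text \<open>With \<open>r\<close> the smallest slope \<open>v(a\<^sub>i) / (n + 1 - i)\<close> of the Newton polygon, the polynomial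
\<open>X\<^bsup>-r(n+1)\<^esup> Q(X\<^sup>r Y)\<close> is monic with integral coefficients, and a coefficient at which the minimum
is attained becomes a unit. It therefore has a proper factor, and a root of the factor, scaled back, is a
root of \<open>Q\<close>.\<close>

lemma puiseux_poly_root_depressed:
  fixes Q :: "'l::{alg_closed_field, field_char_0} puiseux poly"
  assumes deg: "degree Q = Suc n" and monic: "lead_coeff Q = 1" and sub: "coeff Q n = 0"
    and IH: "\<And>A :: 'l puiseux poly. 0 < degree A \<Longrightarrow> degree A < Suc n \<Longrightarrow> lead_coeff A = 1 \<Longrightarrow>
      \<exists>x. poly A x = 0"
  shows "\<exists>x. poly Q x = 0"
proof (cases "coeff Q 0 = 0")
  case True
  then show ?thesis by (intro exI[of _ 0]) (simp add: poly_0_coeff_0)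
next
  case Q0: False
  define I where "I = {i. i < Suc n \<and> coeff Q i \<noteq> 0}"
  have fin: "finite I" by (simp add: I_def)
  have I0: "0 \<in> I" using Q0 by (simp add: I_def)
  have "\<exists>r. val_ge r (coeff Q i) \<and> pcoeff (coeff Q i) r \<noteq> 0" if "i \<in> I" for i
    using that pcoeff_lowest_ex[of "coeff Q i"] by (auto simp: I_def)
  then obtain v where v: "\<And>i. i \<in> I \<Longrightarrow> val_ge (v i) (coeff Q i)"
    "\<And>i. i \<in> I \<Longrightarrow> pcoeff (coeff Q i) (v i) \<noteq> 0" by metis
  define s where "s = (\<lambda>i. v i / of_nat (Suc n - i))"
  define r where "r = Min (s ` I)"
  obtain i where i: "i \<in> I" "r = s i" using Min_in[of "s ` I"] fin I0 unfolding r_def by blast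
  have r: "r * of_nat (Suc n - j) \<le> v j" if "j \<in> I" for j
  proof -
    have "r \<le> s j" using that fin by (simp add: r_def)
    moreover have "(of_nat (Suc n - j) :: rat) > 0" using that by (simp add: I_def)
    ultimately show ?thesis unfolding s_def by (simp only: pos_le_divide_eq)
  qed
  have ri: "r * of_nat (Suc n - i) = v i" using i by (simp add: s_def I_def)
  obtain R where cR: "\<And>j. coeff R j =
      (if j \<le> Suc n then puiseux_monom (r * (of_nat j - of_nat (Suc n))) * coeff Q j else 0)"
    using poly_of_coeff_fun[of "Suc n" "\<lambda>j. puiseux_monom (r * (of_nat j - of_nat (Suc n))) * coeff Q j"]
    by blast
  \<comment> \<open>Scaling keeps \<open>R\<close> monic, since the exponent of the monomial is 0 at the top index.\<close>
  have Rtop: "coeff R (Suc n) = 1" using monic deg by (simp add: cR puiseux_monom_0)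
  have degR: "degree R = Suc n"
    by (intro antisym degree_le le_degree) (use Rtop in \<open>auto simp: cR\<close>)
  have val: "val_ge 0 (coeff R j)" for j
  proof (cases "j \<in> I")
    case True
    then have "j < Suc n" by (simp add: I_def)
    then have e: "0 - r * (of_nat j - of_nat (Suc n)) = r * of_nat (Suc n - j)"
      by (simp add: of_nat_diff algebra_simps)
    show ?thesis
      using True v(1) r[OF True] \<open>j < Suc n\<close> unfolding cR
      by (simp only: if_True less_imp_le val_ge_monom_mult e) (rule val_ge_mono)
  next
    case False
    then show ?thesis using Rtop by (cases "j = Suc n") (auto simp: cR I_def val_ge_1)
  qed
  have i': "i < Suc n" using i by (simp add: I_def)
  have pi: "pcoeff (coeff R i) 0 \<noteq> 0"
  proof -
    have "0 - r * (of_nat i - of_nat (Suc n)) = v i"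
      using ri i' by (simp add: of_nat_diff algebra_simps)
    then show ?thesis using v(2)[OF i(1)] i' by (simp add: cR pcoeff_monom_mult)
  qed
  obtain A where A: "A dvd R" "degree A < degree R" "degree A > 0" "lead_coeff A = 1"
    by (rule newton_puiseux_proper_factor[OF degR _ val _ i' pi]) (use Rtop degR sub in \<open>auto simp: cR\<close>)
  obtain x where "poly A x = 0" using IH A degR by auto
  with A(1) have x: "poly R x = 0" by (auto elim!: dvdE)
  have "poly Q (puiseux_monom r * x) = puiseux_monom (r * of_nat (Suc n)) * poly R x"
    unfolding poly_altdef deg degR sum_distrib_left
  proof (rule sum.cong[OF refl])
    fix j assume "j \<in> {..Suc n}"
    have "(puiseux_monom (of_nat j * r) :: 'l puiseux) =
        puiseux_monom (r * of_nat (Suc n) + r * (of_nat j - of_nat (Suc n)))"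
      by (rule arg_cong[of _ _ puiseux_monom]) (simp add: algebra_simps)
    then show "coeff Q j * (puiseux_monom r * x) ^ j =
        puiseux_monom (r * of_nat (Suc n)) * (coeff R j * x ^ j)"
      using \<open>j \<in> {..Suc n}\<close>
      by (simp only: cR power_mult_distrib puiseux_monom_power puiseux_monom_add atMost_iff if_True mult_ac)
  qed
  then show ?thesis using x by (intro exI[of _ "puiseux_monom r * x"]) simp
qed

text \<open>The substitution \<open>Y \<mapsto> Y - a\<^sub>n/(n + 1)\<close> removes the subleading coefficient; the division needs
characteristic zero.\<close>

theorem puiseux_poly_has_root:
  fixes P :: "'l::{alg_closed_field, field_char_0} puiseux poly"
  assumes "degree P > 0" "lead_coeff P = 1"
  shows "\<exists>x. poly P x = 0"
  using assms
proof (induction "degree P" arbitrary: P rule: less_induct)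
  case less
  obtain n where n: "degree P = Suc n" using less.prems(1) by (cases "degree P") auto
  define c where "c = coeff P n / of_nat (Suc n)"
  define Q where "Q = pcompose P [:- c, 1:]"
  have top: "coeff P i = 0" if "i > Suc n" for i using that n by (simp add: coeff_eq_0)
  have degQ: "degree Q = Suc n" by (simp add: Q_def degree_pcompose n)
  have ne: "of_nat (Suc n) \<noteq> (0 :: 'l puiseux)" by (simp only: of_nat_eq_0_iff)
  have "coeff Q (Suc n) = 1" using coeff_shift_top(1)[OF top] less.prems(2) n by (simp add: Q_def)
  moreover have "coeff Q n = 0"
    using coeff_shift_top(2)[where c = c, OF top] less.prems(2) n ne by (simp add: Q_def c_def del: of_nat_Suc)
  ultimately obtain x where "poly Q x = 0"
    using puiseux_poly_root_depressed[OF degQ] less.hyps degQ n by metis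
  then show ?case by (auto simp: Q_def poly_pcompose)
qed

instance puiseux :: ("{alg_closed_field, field_char_0}") alg_closed_field
  by (rule alg_closedI) (rule puiseux_poly_has_root)


section \<open>Laurent series inside Puiseux series\<close>

text \<open>The convolution over an arbitrary finite superset of its support, for comparison with the Cauchy product
of Puiseux series, which is a sum over exactly the support.\<close>

lemma fls_times_nth_support:
  fixes F G :: "'a::comm_ring_1 fls"
  assumes "finite S" "{i. fls_nth F i \<noteq> 0 \<and> fls_nth G (n - i) \<noteq> 0} \<subseteq> S"
  shows "fls_nth (F * G) n = (\<Sum>i\<in>S. fls_nth F i * fls_nth G (n - i))"
proof -
  let ?I = "{i. fls_nth F i \<noteq> 0 \<and> fls_nth G (n - i) \<noteq> 0}"
  have "(\<Sum>i=fls_subdegree F..n - fls_subdegree G. fls_nth F i * fls_nth G (n - i)) =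
      (\<Sum>i\<in>?I. fls_nth F i * fls_nth G (n - i))"
  proof (rule sum.mono_neutral_right)
    show "?I \<subseteq> {fls_subdegree F..n - fls_subdegree G}"
    proof
      fix i assume "i \<in> ?I"
      then have "fls_subdegree F \<le> i" "fls_subdegree G \<le> n - i"
        by (auto intro: fls_subdegree_leI)
      then show "i \<in> {fls_subdegree F..n - fls_subdegree G}" by auto
    qed
  qed auto
  also have "\<dots> = (\<Sum>i\<in>S. fls_nth F i * fls_nth G (n - i))"
    by (rule sum.mono_neutral_left) (use assms in auto)
  finally show ?thesis by (simp add: fls_times_nth(2))
qed

lemma finite_fls_support:
  fixes F :: "'a::zero fls"
  assumes "\<And>j. j < N \<Longrightarrow> g j = 0"
  shows "finite {i. fls_nth F i \<noteq> 0 \<and> g (n - i) \<noteq> (0::'b::zero)}"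
proof (rule finite_subset)
  show "{i. fls_nth F i \<noteq> 0 \<and> g (n - i) \<noteq> 0} \<subseteq> {fls_subdegree F..n - N}"
  proof
    fix i assume i: "i \<in> {i. fls_nth F i \<noteq> 0 \<and> g (n - i) \<noteq> 0}"
    then have "fls_subdegree F \<le> i" by (auto intro: fls_subdegree_leI)
    moreover have "\<not> n - i < N" using i assms by auto
    ultimately show "i \<in> {fls_subdegree F..n - N}" by auto
  qed
qed simp

lemma pcoeff_sum: "pcoeff (\<Sum>i\<in>A. f i) r = (\<Sum>i\<in>A. pcoeff (f i) r)"
  for f :: "_ \<Rightarrow> 'a::comm_ring_1 puiseux"
  by (induction A rule: infinite_finite_induct) simp_all

locale puiseux_embedding =
  fixes \<iota> :: "'k::field_char_0 \<Rightarrow> 'l::{alg_closed_field, field_char_0}"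
  assumes iota_hom: "unital_hom \<iota>"
begin

sublocale i: unital_hom \<iota> by (rule iota_hom)

lemma iota_eq_0 [simp]: "\<iota> c = 0 \<longleftrightarrow> c = 0"
proof
  assume "\<iota> c = 0"
  show "c = 0"
  proof (rule ccontr)
    assume "c \<noteq> 0"
    then have "\<iota> (c * inverse c) = 1" by (simp add: i.hom_one)
    with \<open>\<iota> c = 0\<close> show False by (simp add: i.hom_mult)
  qed
qed (simp add: i.hom_zero)

definition emb :: "'k fls \<Rightarrow> 'l puiseux" where
  "emb F = puiseux_of_fls 1 (Abs_fls (\<lambda>n. \<iota> (fls_nth F n)))"

lemma fls_nth_map: "fls_nth (Abs_fls (\<lambda>n. \<iota> (fls_nth F n))) n = \<iota> (fls_nth F n)"
  by (rule nth_Abs_fls_lower_bound[of "fls_subdegree F"]) (simp add: i.hom_zero)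

lemma pcoeff_emb: "pcoeff (emb F) r = (if r \<in> \<int> then \<iota> (fls_nth F \<lfloor>r\<rfloor>) else 0)"
  by (simp add: emb_def pcoeff_of_fls puiseux_nth_def fls_nth_map)

lemma pcoeff_emb_of_int [simp]: "pcoeff (emb F) (of_int n) = \<iota> (fls_nth F n)"
  by (simp add: pcoeff_emb)

lemma pcoeff_emb_mult:
  "pcoeff (emb F * f) (of_int n) =
    (\<Sum>i | fls_nth F i \<noteq> 0 \<and> pcoeff f (of_int (n - i)) \<noteq> 0. \<iota> (fls_nth F i) * pcoeff f (of_int (n - i)))"
proof -
  let ?I = "{i. fls_nth F i \<noteq> 0 \<and> pcoeff f (of_int (n - i)) \<noteq> 0}"
  have "{s. pcoeff (emb F) s \<noteq> 0 \<and> pcoeff f (of_int n - s) \<noteq> 0} = of_int ` ?I"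
    (is "?S = _")
  proof (intro equalityI subsetI)
    fix s assume s: "s \<in> ?S"
    then have "s \<in> \<int>" by (auto simp: pcoeff_emb split: if_splits)
    then obtain i where i: "s = of_int i" by (elim Ints_cases)
    with s have "i \<in> ?I" by auto
    with i show "s \<in> of_int ` ?I" by blast
  qed auto
  then have "pcoeff (emb F * f) (of_int n) =
      (\<Sum>s\<in>of_int ` ?I. pcoeff (emb F) s * pcoeff f (of_int n - s))"
    by (simp only: pcoeff_mult)
  also have "\<dots> = (\<Sum>i\<in>?I. \<iota> (fls_nth F i) * pcoeff f (of_int (n - i)))"
    by (subst sum.reindex) (auto simp: inj_on_def)
  finally show ?thesis .
qed

lemma emb_mult: "emb (F * G) = emb F * emb G"
proof (rule puiseux_eqI)
  fix r
  show "pcoeff (emb (F * G)) r = pcoeff (emb F * emb G) r"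
  proof (cases "r \<in> \<int>")
    case True
    then obtain n where r: "r = of_int n" by (elim Ints_cases)
    have "finite {i. fls_nth F i \<noteq> 0 \<and> fls_nth G (n - i) \<noteq> 0}"
      by (rule finite_fls_support[of "fls_subdegree G"]) simp
    then show ?thesis
      by (simp del: of_int_diff add: r pcoeff_emb_mult fls_times_nth_support[OF _ subset_refl] i.hom_sum i.hom_mult)
  next
    case False
    have "{s. pcoeff (emb F) s \<noteq> 0 \<and> pcoeff (emb G) (r - s) \<noteq> 0} = {}"
    proof (rule ccontr)
      assume "{s. pcoeff (emb F) s \<noteq> 0 \<and> pcoeff (emb G) (r - s) \<noteq> 0} \<noteq> {}"
      then obtain s where "s \<in> \<int>" "r - s \<in> \<int>" by (auto simp: pcoeff_emb split: if_splits)
      then have "s + (r - s) \<in> \<int>" by (rule Ints_add)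
      with False show False by simp
    qed
    then have "pcoeff (emb F * emb G) r = 0" by (simp only: pcoeff_mult sum.empty)
    with False show ?thesis by (simp add: pcoeff_emb)
  qed
qed

sublocale e: unital_hom emb
proof
  show "emb (F + G) = emb F + emb G" for F G
    by (rule puiseux_eqI) (simp add: pcoeff_emb i.hom_add)
  show "emb (F * G) = emb F * emb G" for F G by (rule emb_mult)
  show "emb 1 = 1"
    by (rule puiseux_eqI) (auto simp: pcoeff_emb pcoeff_one i.hom_one i.hom_zero elim!: Ints_cases)
qed

lemma emb_eq_0 [simp]: "emb F = 0 \<longleftrightarrow> F = 0"
proof
  assume "emb F = 0"
  then have "pcoeff (emb F) (of_int n) = 0" for n by simp
  then show "F = 0" by (intro fls_eqI) simp
qed (simp add: e.hom_zero)

lemma val_ge_emb: "val_ge (of_int n) (emb F) \<longleftrightarrow> (\<forall>k<n. fls_nth F k = 0)"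
proof
  assume "val_ge (of_int n) (emb F)"
  then show "\<forall>k<n. fls_nth F k = 0"
    by (auto simp: val_ge_def dest: spec[of _ "of_int _"])
next
  assume *: "\<forall>k<n. fls_nth F k = 0"
  show "val_ge (of_int n) (emb F)"
    unfolding val_ge_def
  proof (intro allI impI)
    fix s :: rat assume "s < of_int n"
    then have "\<lfloor>s\<rfloor> < n" by (simp add: floor_less_iff)
    with * show "pcoeff (emb F) s = 0" by (simp add: pcoeff_emb i.hom_zero)
  qed
qed

lemma fls_regpart_if_nth_neg: "(\<And>k. k < 0 \<Longrightarrow> fls_nth F k = 0) \<Longrightarrow> F = fps_to_fls (fls_regpart F)"
  for F :: "'k fls"
  by (rule fls_eqI) simp

lemma val_ge_emb_fps: "val_ge 0 (emb (fps_to_fls c))"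
  using val_ge_emb[of 0 "fps_to_fls c"] by simp

lemma emb_integral: "val_ge 0 (emb F) \<Longrightarrow> F = fps_to_fls (fls_regpart F)"
  using val_ge_emb[of 0 F] fls_regpart_if_nth_neg[of F] by simp

lemma emb_X_intpow: "emb (fls_X_intpow n) = puiseux_monom (of_int n)"
proof (rule puiseux_eqI)
  fix r :: rat
  show "pcoeff (emb (fls_X_intpow n)) r = pcoeff (puiseux_monom (of_int n)) r"
    by (auto simp: pcoeff_emb pcoeff_puiseux_monom i.hom_one i.hom_zero elim!: Ints_cases)
qed

lemma puiseux_poly_eq: "puiseux_poly \<iota> q = map_poly emb (laurent_poly q)"
proof -
  have "Abs_fls (\<lambda>n. \<iota> (fls_nth (fps_to_fls c) n)) = fps_to_fls (Abs_fps (\<lambda>n. \<iota> (fps_nth c n)))" for c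
    by (rule fls_eqI) (simp add: fls_nth_map i.hom_zero)
  then have "(\<lambda>c. puiseux_of_fls 1 (fps_to_fls (Abs_fps (\<lambda>n. \<iota> (fps_nth c n))))) = emb \<circ> fps_to_fls"
    by (simp add: emb_def fun_eq_iff)
  then show ?thesis
    by (simp add: puiseux_poly_def laurent_poly_def map_poly_map_poly e.hom_zero)
qed

text \<open>\<open>K\<close> is a direct summand of the \<open>K\<close>-vector space \<open>L\<close>: extend \<open>{1}\<close> to a basis.\<close>

lemma linear_retraction_ex:
  obtains lam :: "'l \<Rightarrow> 'k" where "\<And>x y. lam (x + y) = lam x + lam y"
    "\<And>c x. lam (\<iota> c * x) = c * lam x" "lam 1 = 1"
proof -
  interpret vector_space_pair "\<lambda>c x. \<iota> c * x" "(*) :: 'k \<Rightarrow> 'k \<Rightarrow> 'k"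
    by unfold_locales (simp_all add: algebra_simps i.hom_add i.hom_mult i.hom_one)
  have ind: "vs1.independent {1}"
    by (subst vs1.dependent_single) simp
  obtain f where f: "Vector_Spaces.linear (\<lambda>c x. \<iota> c * x) (*) f" "f 1 = (1::'k)"
    using linear_independent_extend[OF ind, of "\<lambda>_. 1"] by auto
  interpret f: Vector_Spaces.linear "\<lambda>c x. \<iota> c * x" "(*)" f by (rule f(1))
  show ?thesis using that[of f] f(2) f.add f.scale by blast
qed

text \<open>Forgetting the terms with non-integral exponents and applying a \<open>K\<close>-linear retraction of \<open>L\<close>
onto \<open>K\<close> to the other coefficients is \<open>K((X))\<close>-linear, because multiplication by a Laurent
series over \<open>K\<close> shifts exponents by integers and scales coefficients by elements of \<open>K\<close>. No
exponent is lowered, so integral series go to power series.\<close>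

lemma laurent_projection_ex:
  obtains \<pi> :: "'l puiseux \<Rightarrow> 'k fls" where "\<And>f g. \<pi> (f + g) = \<pi> f + \<pi> g"
    "\<And>F f. \<pi> (emb F * f) = F * \<pi> f" "\<pi> 1 = 1"
    "\<And>f. val_ge 0 f \<Longrightarrow> \<exists>c. \<pi> f = fps_to_fls c"
proof -
  obtain lam :: "'l \<Rightarrow> 'k" where l: "\<And>x y. lam (x + y) = lam x + lam y"
    "\<And>c x. lam (\<iota> c * x) = c * lam x" "lam 1 = 1" by (rule linear_retraction_ex) blast
  have l0: "lam 0 = 0" using l(1)[of 0 0] by simp
  have lsum: "lam (sum f A) = (\<Sum>a\<in>A. lam (f a))" for f :: "int \<Rightarrow> 'l" and A
    by (induction A rule: infinite_finite_induct) (simp_all add: l0 l(1))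
  define \<pi> where "\<pi> = (\<lambda>f. Abs_fls (\<lambda>n. lam (pcoeff f (of_int n))))"
  have low: "\<exists>N. \<forall>n<N. pcoeff f (of_int n) = 0" for f :: "'l puiseux"
  proof -
    obtain r where "val_ge r f" using val_ge_ex by blast
    then have "\<forall>n<\<lfloor>r\<rfloor>. pcoeff f (of_int n) = 0" by (simp add: val_ge_def less_floor_iff)
    then show ?thesis by blast
  qed
  have nth: "fls_nth (\<pi> f) n = lam (pcoeff f (of_int n))" for f n
    unfolding \<pi>_def by (rule nth_Abs_fls_ex_lower_bound) (use low[of f] l0 in metis)
  show ?thesis
  proof (rule that[of \<pi>])
    show "\<pi> (f + g) = \<pi> f + \<pi> g" for f g by (rule fls_eqI) (simp add: nth l(1))
    show "\<pi> 1 = 1" by (rule fls_eqI) (simp add: nth pcoeff_one l(3) l0)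
    show "\<pi> (emb F * f) = F * \<pi> f" for F f
    proof (rule fls_eqI)
      fix n
      let ?I = "{i. fls_nth F i \<noteq> 0 \<and> pcoeff f (of_int (n - i)) \<noteq> 0}"
      obtain N where "\<forall>j<N. pcoeff f (of_int j) = 0" using low by blast
      then have fin: "finite ?I"
        by (intro finite_fls_support[of N "\<lambda>j. pcoeff f (of_int j)"]) auto
      have "fls_nth (F * \<pi> f) n = (\<Sum>i\<in>?I. fls_nth F i * fls_nth (\<pi> f) (n - i))"
        by (rule fls_times_nth_support[OF fin]) (auto simp: nth l0)
      then show "fls_nth (\<pi> (emb F * f)) n = fls_nth (F * \<pi> f) n"
        by (simp add: nth pcoeff_emb_mult lsum l(2))
    qed
    fix f :: "'l puiseux" assume "val_ge 0 f"
    then have "fls_nth (\<pi> f) k = 0" if "k < 0" for k using that by (simp add: nth val_ge_def l0)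
    then show "\<exists>c. \<pi> f = fps_to_fls c" using fls_regpart_if_nth_neg by blast
  qed
qed

end

section \<open>Integral elements over the valuation ring of Puiseux series\<close>

text \<open>If \<open>x\<close> had valuation \<open>r < 0\<close>, the term \<open>x\<^sup>n\<close> would contribute at exponent \<open>n r\<close>, strictly
below all exponents of the remaining terms, and could not cancel. So
the valuation ring of \<open>L{{X}}\<close> is integrally closed.\<close>

lemma val_ge_0_root:
  fixes x :: "'a::field puiseux"
  assumes c: "\<And>i. i < n \<Longrightarrow> val_ge 0 (c i)" and eq: "x ^ n + (\<Sum>i<n. c i * x ^ i) = 0"
  shows "val_ge 0 x"
proof (rule ccontr)
  assume *: "\<not> val_ge 0 x"
  then have "x \<noteq> 0" by auto
  then obtain r where r: "val_ge r x" "pcoeff x r \<noteq> 0" by (rule pcoeff_lowest_ex)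
  have "r < 0" using r * val_ge_mono by (metis not_le)
  have pow: "pcoeff (x ^ j) (of_nat j * r) = pcoeff x r ^ j" for j
  proof (induction j)
    case (Suc j)
    then show ?case
      using pcoeff_mult_lowest[OF r(1) val_ge_power[OF r(1), of j]] by (simp add: algebra_simps)
  qed (simp add: pcoeff_one)
  have "pcoeff (c i * x ^ i) (of_nat n * r) = 0" if "i < n" for i
  proof -
    have "val_ge (of_nat i * r) (c i * x ^ i)" by (intro val_ge_mult0 c that val_ge_power r)
    moreover have "of_nat n * r < of_nat i * r" using that \<open>r < 0\<close> by simp
    ultimately show ?thesis by (simp add: val_ge_def)
  qed
  then have "pcoeff (\<Sum>i<n. c i * x ^ i) (of_nat n * r) = 0"
    by (simp add: pcoeff_sum)
  then have "pcoeff (x ^ n + (\<Sum>i<n. c i * x ^ i)) (of_nat n * r) = pcoeff x r ^ n"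
    by (simp add: pow)
  with eq r(2) show False by simp
qed

lemma val_ge_0_root_monic:
  fixes P :: "'a::field puiseux poly"
  assumes "lead_coeff P = 1" "\<And>i. val_ge 0 (coeff P i)" "poly P x = 0"
  shows "val_ge 0 x"
proof (rule val_ge_0_root)
  show "x ^ degree P + (\<Sum>i<degree P. coeff P i * x ^ i) = 0"
    using assms(1,3) by (simp add: poly_altdef lessThan_Suc_atMost[symmetric] add.commute)
qed (rule assms(2))

lemma val_ge_0_coeff_mult:
  fixes P Q :: "'a::comm_ring_1 puiseux poly"
  assumes "\<And>i. val_ge 0 (coeff P i)" "\<And>i. val_ge 0 (coeff Q i)"
  shows "val_ge 0 (coeff (P * Q) i)"
  unfolding coeff_mult by (intro val_ge_sum val_ge_mult0 assms)

lemma val_ge_0_coeff_prod_linear: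
  fixes A :: "'a::comm_ring_1 puiseux multiset"
  assumes "\<And>x. x \<in># A \<Longrightarrow> val_ge 0 x"
  shows "val_ge 0 (coeff (\<Prod>x\<in>#A. [:- x, 1:]) i)"
  using assms
proof (induction A arbitrary: i)
  case empty
  show ?case by (cases "i = 0") (simp_all add: coeff_1 val_ge_1)
next
  case (add x A)
  have "val_ge 0 (coeff [:- x, 1:] j)" for j
    using add.prems[of x] by (auto simp: coeff_pCons val_ge_1 val_ge_uminus split: nat.splits)
  then show ?case using add by (simp only: image_mset_add_mset prod_mset.add_mset) (intro val_ge_0_coeff_mult, auto)
qed

text \<open>The coefficients of a monic polynomial that splits are integer polynomials in its roots.\<close>

lemma val_ge_0_coeff_if_roots:
  fixes P :: "'l::{alg_closed_field, field_char_0} puiseux poly"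
  assumes "lead_coeff P = 1" "\<And>x. poly P x = 0 \<Longrightarrow> val_ge 0 x"
  shows "val_ge 0 (coeff P i)"
proof -
  have "P \<noteq> 0" using assms(1) by auto
  then obtain A where A: "P = smult (lead_coeff P) (\<Prod>x\<in>#A. [:- x, 1:])"
    using alg_closed_imp_factorization by blast
  then have P: "P = (\<Prod>x\<in>#A. [:- x, 1:])" using assms(1) by simp
  have "val_ge 0 x" if "x \<in># A" for x
  proof (rule assms(2))
    show "poly P x = 0" using that unfolding P by (auto simp: poly_prod_mset image_mset.compositionality)
  qed
  then show ?thesis unfolding P by (rule val_ge_0_coeff_prod_linear)
qed


section \<open>The roots of g\<close>

lemma laurent_poly_hom: "unital_hom (laurent_poly :: 'a::comm_ring_1 fps poly \<Rightarrow> 'a fls poly)"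
  unfolding laurent_poly_def by (rule unital_hom.unital_hom_map_poly[OF fps_to_fls_hom])

lemma coeff_laurent_poly [simp]: "coeff (laurent_poly q) i = fps_to_fls (coeff q i)"
  by (simp add: laurent_poly_def coeff_map_poly)

lemma laurent_poly_inject: "laurent_poly p = laurent_poly q \<longleftrightarrow> p = q"
  by (simp add: poly_eq_iff)

lemma degree_laurent_poly [simp]: "degree (laurent_poly q) = degree q"
  unfolding laurent_poly_def by (rule degree_map_poly) simp

lemma laurent_poly_if_coeffs_integral:
  assumes "\<And>i. coeff f i = fps_to_fls (fls_regpart (coeff f i))"
  obtains q where "f = laurent_poly q"
proof
  show "f = laurent_poly (map_poly fls_regpart f)"
    by (rule poly_eqI) (use assms in \<open>simp add: coeff_map_poly\<close>)
qed

lemma monic_degree_0: "lead_coeff q = 1 \<Longrightarrow> degree q = 0 \<Longrightarrow> q = 1"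
  by (auto elim!: degree_eq_zeroE simp: one_pCons)

interpretation lp: unital_hom laurent_poly by (rule laurent_poly_hom)

locale squarefree_over_power_series = puiseux_embedding \<iota>
  for \<iota> :: "'k::field_char_0 \<Rightarrow> 'l::{alg_closed_field, field_char_0}" +
  fixes g :: "'k fps poly"
  assumes monic: "lead_coeff g = 1" and degree_pos: "degree g \<ge> 1" and squarefree: "squarefree g"
begin

definition ev :: "'k fls poly \<Rightarrow> 'l puiseux \<Rightarrow> 'l puiseux" where
  "ev f \<gamma> = poly (map_poly emb f) \<gamma>"

abbreviation "roots \<equiv> puiseux_expansions \<iota> g"

abbreviation "G \<equiv> laurent_poly g"

sublocale em: unital_hom "map_poly emb" by (rule e.unital_hom_map_poly)

lemma ev_add: "ev (p + q) \<gamma> = ev p \<gamma> + ev q \<gamma>" by (simp add: ev_def em.hom_add)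
lemma ev_diff: "ev (p - q) \<gamma> = ev p \<gamma> - ev q \<gamma>" by (simp add: ev_def em.hom_diff)
lemma ev_mult: "ev (p * q) \<gamma> = ev p \<gamma> * ev q \<gamma>" by (simp add: ev_def em.hom_mult)
lemma ev_power: "ev (p ^ n) \<gamma> = ev p \<gamma> ^ n" by (simp add: ev_def em.hom_power)
lemma ev_sum: "ev (\<Sum>i\<in>A. f i) \<gamma> = (\<Sum>i\<in>A. ev (f i) \<gamma>)" by (simp add: ev_def em.hom_sum poly_sum)
lemma ev_smult: "ev (smult c p) \<gamma> = emb c * ev p \<gamma>" by (simp add: ev_def e.map_poly_hom_smult)
lemma ev_1: "ev 1 \<gamma> = 1" by (simp add: ev_def em.hom_one)
lemma ev_0: "ev 0 \<gamma> = 0" by (simp add: ev_def)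
lemmas ev_simps = ev_add ev_diff ev_mult ev_power ev_sum ev_smult ev_1 ev_0

lemma roots_iff: "\<gamma> \<in> roots \<longleftrightarrow> ev G \<gamma> = 0"
  by (simp add: puiseux_expansions_def ev_def puiseux_poly_eq)

lemma monic_G: "lead_coeff G = 1" using monic by simp

lemma embG: "degree (map_poly emb G) = degree g" "lead_coeff (map_poly emb G) = 1"
  using e.degree_map_poly_monic[OF monic_G] by simp_all

lemma embG_nonzero: "map_poly emb G \<noteq> 0" using embG(2) by auto

lemma G_nonzero: "G \<noteq> 0" using embG_nonzero by auto

lemma finite_roots: "finite roots"
  using poly_roots_finite[OF embG_nonzero] by (simp add: puiseux_expansions_def puiseux_poly_eq)

lemma val_ge_0_coeff_laurent: "val_ge 0 (coeff (map_poly emb (laurent_poly q)) i)"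
  by (simp add: e.coeff_map val_ge_emb_fps)

lemma root_integral: "\<gamma> \<in> roots \<Longrightarrow> val_ge 0 \<gamma>"
  using val_ge_0_root_monic[OF embG(2) val_ge_0_coeff_laurent] by (simp add: roots_iff ev_def)

lemma ev_laurent_poly_integral: "val_ge 0 \<gamma> \<Longrightarrow> val_ge 0 (ev (laurent_poly q) \<gamma>)"
  unfolding ev_def by (intro val_ge_poly val_ge_0_coeff_laurent)

text \<open>A form of Gauss's lemma: the roots of a factor of \<open>g\<close> are among the roots of \<open>g\<close>, hence
integral, and therefore so are the coefficients of the factor.\<close>

lemma monic_factor_integral:
  assumes "h dvd G" "lead_coeff h = 1"
  obtains q where "h = laurent_poly q"
proof (rule laurent_poly_if_coeffs_integral)
  fix i
  have "val_ge 0 (coeff (map_poly emb h) i)"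
  proof (rule val_ge_0_coeff_if_roots)
    show "lead_coeff (map_poly emb h) = 1" by (rule e.degree_map_poly_monic[OF assms(2)])
    fix x assume "poly (map_poly emb h) x = 0"
    then have "x \<in> roots" using assms(1) by (auto simp: roots_iff ev_mult ev_def[of h] elim!: dvdE)
    then show "val_ge 0 x" by (rule root_integral)
  qed
  then show "coeff h i = fps_to_fls (fls_regpart (coeff h i))"
    by (intro emb_integral) (simp add: e.coeff_map)
qed (rule that)

lemma map_poly_emb_pderiv: "map_poly emb (pderiv f) = pderiv (map_poly emb f)"
proof -
  have n: "emb (of_nat n) = of_nat n" for n by (induction n) (simp_all add: e.hom_zero e.hom_add e.hom_one)
  show ?thesis
    by (rule poly_eqI) (simp add: e.coeff_map coeff_pderiv e.hom_mult n[of "Suc _", simplified] e.hom_add e.hom_one n)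
qed

text \<open>The minimal polynomial of \<open>\<gamma>\<close> over \<open>K((X))\<close>.\<close>

lemma ev_eq_0_minimal:
  assumes "f \<noteq> 0" "ev f \<gamma> = 0"
  obtains h where "lead_coeff h = 1" "degree h > 0" "ev h \<gamma> = 0"
    "\<And>q. ev q \<gamma> = 0 \<Longrightarrow> h dvd q"
proof -
  define P where "P = (\<lambda>n. \<exists>q. q \<noteq> 0 \<and> ev q \<gamma> = 0 \<and> degree q = n)"
  have "P (degree f)" using assms by (auto simp: P_def)
  then have "P (LEAST n. P n)" by (rule LeastI)
  then obtain q where q: "q \<noteq> 0" "ev q \<gamma> = 0" "degree q = (LEAST n. P n)" by (auto simp: P_def)
  have least: "degree q \<le> degree r" if "r \<noteq> 0" "ev r \<gamma> = 0" for r
    unfolding q(3) by (rule Least_le) (use that in \<open>auto simp: P_def\<close>)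
  define h where "h = smult (inverse (lead_coeff q)) q"
  have h: "lead_coeff h = 1" "ev h \<gamma> = 0" "degree h = degree q"
    using q(1,2) by (simp_all add: h_def ev_smult)
  have hne: "h \<noteq> 0" using h(1) by auto
  have "degree h \<noteq> 0"
  proof
    assume "degree h = 0"
    with h(1) have "h = 1" by (rule monic_degree_0)
    with h(2) show False by (simp add: ev_1)
  qed
  moreover have "h dvd r" if r: "ev r \<gamma> = 0" for r
  proof -
    have "r mod h = r - h * (r div h)" by (simp add: minus_mult_div_eq_mod)
    then have "ev (r mod h) \<gamma> = 0" using r h(2) by (simp add: ev_diff ev_mult)
    moreover have "degree (r mod h) < degree q \<or> r mod h = 0"
      using degree_mod_less[of h r] hne h(3) by auto
    ultimately have "r mod h = 0" using least[of "r mod h"] by fastforce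
    then show ?thesis by auto
  qed
  ultimately show ?thesis using that h by blast
qed

text \<open>Let \<open>h\<close> be the minimal polynomial of \<open>\<gamma>\<close> and \<open>g = h k\<close>. As \<open>h'(\<gamma>) \<noteq> 0\<close> in characteristic zero, a
double root forces \<open>k(\<gamma>) = 0\<close>, so \<open>h\<^sup>2\<close> divides \<open>g\<close> over \<open>K((X))\<close>. All factors are monic,
so by the preceding form of Gauss's lemma the division takes place over \<open>K[[X]]\<close>, contrary to
\<open>g\<close> being square-free there.\<close>

lemma simple_roots: "\<gamma> \<in> roots \<Longrightarrow> poly (pderiv (map_poly emb G)) \<gamma> \<noteq> 0"
proof
  assume "\<gamma> \<in> roots" and d: "poly (pderiv (map_poly emb G)) \<gamma> = 0"
  then have G0: "ev G \<gamma> = 0" by (simp add: roots_iff)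
  from ev_eq_0_minimal[OF G_nonzero G0] obtain h where
    h: "lead_coeff h = 1" "degree h > 0" "ev h \<gamma> = 0" "\<And>q. ev q \<gamma> = 0 \<Longrightarrow> h dvd q" by blast
  obtain k where k: "G = h * k" using h(4)[OF G0] by blast
  have "h dvd k"
  proof (rule h(4))
    have "\<not> h dvd pderiv h"
    proof
      assume "h dvd pderiv h"
      moreover have "pderiv h \<noteq> 0" using h(2) by (simp add: pderiv_eq_0_iff)
      ultimately have "degree h \<le> degree (pderiv h)" by (rule dvd_imp_degree_le)
      with h(2) show False by (simp add: degree_pderiv)
    qed
    then have "ev (pderiv h) \<gamma> \<noteq> 0" using h(4) by blast
    moreover have "ev (pderiv h) \<gamma> * ev k \<gamma> = 0"
      using d h(3) by (simp add: map_poly_emb_pderiv[symmetric] k ev_def[symmetric] pderiv_mult ev_add ev_mult mult.commute)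
    ultimately show "ev k \<gamma> = 0" by simp
  qed
  then obtain l where l: "k = h * l" by blast
  have "lead_coeff l = 1" using monic_G h(1) by (simp only: k l lead_coeff_mult) simp
  moreover have "l dvd G" "h dvd G" by (simp_all add: k l)
  ultimately obtain l' h' where lh: "l = laurent_poly l'" "h = laurent_poly h'"
    using monic_factor_integral[of l] monic_factor_integral[of h] h(1) by metis
  have "G = laurent_poly (h' ^ 2 * l')"
    by (simp add: k l lh lp.hom_mult lp.hom_power power2_eq_square)
  then have "h' ^ 2 dvd g" by (simp only: laurent_poly_inject) simp
  then have "h' dvd 1" using squarefree by (simp add: squarefree_def)
  then have "degree h' = 0" using dvd_imp_degree_le[of h' 1] by simp
  with h(2) lh show False by simp
qed

lemma card_roots: "card roots = degree g"
proof -
  let ?P = "map_poly emb G"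
  obtain A where A: "size A = degree ?P" "?P = smult (lead_coeff ?P) (\<Prod>x\<in>#A. [:- x, 1:])"
    using alg_closed_imp_factorization[OF embG_nonzero] by blast
  have P: "?P = (\<Prod>x\<in>#A. [:- x, 1:])" using A(2) unfolding embG(2) by (simp only: smult_1_left)
  have roots: "roots = set_mset A"
    by (auto simp: roots_iff ev_def P poly_prod_mset image_mset.compositionality)
  have "count A x = 1" if x: "x \<in># A" for x
  proof (rule ccontr)
    assume "count A x \<noteq> 1"
    moreover have "count A x > 0" using x by simp
    ultimately have "count A x > 1" by linarith
    obtain B where B: "A = add_mset x B" using multi_member_split[OF x] by blast
    with \<open>count A x > 1\<close> have "count B x > 0" by simp
    then have "x \<in># B" by (rule count_greater_zero_iff[THEN iffD1])
    then obtain C where C: "B = add_mset x C" using multi_member_split[OF \<open>x \<in># B\<close>] by blast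
    have "?P = [:- x, 1:] * ([:- x, 1:] * (\<Prod>x\<in>#C. [:- x, 1:]))" unfolding P B C by simp
    then have "poly (pderiv ?P) x = 0" by (simp only: pderiv_mult) simp
    moreover have "x \<in> roots" using x roots by simp
    ultimately show False using simple_roots by blast
  qed
  then have "A = mset_set (set_mset A)"
    by (intro multiset_eqI) (auto simp: count_mset_set' count_eq_zero_iff)
  from arg_cong[OF this, of size] have "size A = card (set_mset A)" by simp
  then show ?thesis using A(1) embG(1) roots by simp
qed

lemma roots_nonempty: "roots \<noteq> {}"
  using card_roots degree_pos by (metis card.empty not_one_le_zero)

text \<open>The remainder of \<open>f\<close> modulo \<open>g\<close> has degree below the number of distinct roots of \<open>g\<close>, so it
is 0 as soon as it vanishes at all of them.\<close>

lemma G_dvd_iff: "G dvd f \<longleftrightarrow> (\<forall>\<gamma>\<in>roots. ev f \<gamma> = 0)"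
proof
  assume "G dvd f"
  then show "\<forall>\<gamma>\<in>roots. ev f \<gamma> = 0" by (auto simp: roots_iff ev_mult elim!: dvdE)
next
  assume *: "\<forall>\<gamma>\<in>roots. ev f \<gamma> = 0"
  define r where "r = f mod G"
  note Gne = G_nonzero
  have "r = f - G * (f div G)" by (simp add: r_def minus_mult_div_eq_mod)
  then have r0: "\<forall>\<gamma>\<in>roots. ev r \<gamma> = 0" using * by (auto simp: ev_diff ev_mult roots_iff)
  have "map_poly emb r = 0"
  proof (rule ccontr)
    assume ne: "map_poly emb r \<noteq> 0"
    then have "r \<noteq> 0" by auto
    then have "degree r < degree g" using degree_mod_less[OF Gne, of f] by (simp add: r_def)
    moreover have "degree (map_poly emb r) \<le> degree r"
      by (rule degree_le) (simp add: e.coeff_map coeff_eq_0 e.hom_zero)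
    moreover have "card roots \<le> card {x. poly (map_poly emb r) x = 0}"
      using r0 by (intro card_mono poly_roots_finite[OF ne]) (auto simp: ev_def)
    moreover have "card {x. poly (map_poly emb r) x = 0} \<le> degree (map_poly emb r)"
      by (rule card_poly_roots_bound[OF ne])
    ultimately show False using card_roots by simp
  qed
  then have "coeff (map_poly emb r) i = 0" for i by simp
  then have "r = 0" by (intro poly_eqI) (simp add: e.coeff_map)
  then show "G dvd f" unfolding r_def by auto
qed

section \<open>Integrality is decided by the Puiseux expansions\<close>

text \<open>Integrality of \<open>f(x, y)\<close>, expressed through the Puiseux expansions; that this agrees with membership
in the normalization is \<open>normalization_eq\<close>.\<close>

definition integral :: "'k fls poly \<Rightarrow> bool" where
  "integral f \<longleftrightarrow> (\<forall>\<gamma>\<in>roots. val_ge 0 (ev f \<gamma>))"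

text \<open>\<open>C(T) = \<Prod>(T - f(\<gamma>))\<close> has integral coefficients \<open>C\<^sub>i\<close> and \<open>C(f)\<close> vanishes at all roots of \<open>g\<close>.
Reducing the powers of \<open>f\<close> modulo \<open>g\<close> to \<open>r\<^sub>i\<close> turns this into \<open>\<Sum> C\<^sub>i r\<^sub>i = 0\<close>, as
there are more roots than the degree allows. For each power of \<open>Y\<close> this is a linear relation
between the \<open>C\<^sub>i\<close> with coefficients in \<open>K((X))\<close>, and the projection \<open>\<pi>\<close> replaces \<open>C\<^sub>i\<close> by power
series over \<open>K\<close> while fixing the leading coefficient 1.\<close>

lemma integral_imp_equation:
  assumes "integral f"
  shows "\<exists>c. G dvd f ^ degree g + (\<Sum>i<degree g. laurent_poly [:c i:] * f ^ i)"
proof -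
  obtain \<pi> where pi: "\<And>f g. \<pi> (f + g) = \<pi> f + \<pi> g" "\<And>F f. \<pi> (emb F * f) = F * \<pi> f" "\<pi> 1 = 1"
    "\<And>f. val_ge 0 f \<Longrightarrow> \<exists>c. \<pi> f = fps_to_fls c" by (rule laurent_projection_ex) blast
  have pi0: "\<pi> 0 = 0" using pi(1)[of 0 0] by simp
  have pisum: "\<pi> (sum F A) = (\<Sum>a\<in>A. \<pi> (F a))" for F :: "nat \<Rightarrow> 'l puiseux" and A
    by (induction A rule: infinite_finite_induct) (simp_all add: pi0 pi(1))
  define C where "C = (\<Prod>\<gamma>\<in>roots. [:- ev f \<gamma>, 1:])"
  define m where "m = degree g"
  have lc: "lead_coeff C = 1" unfolding C_def by (simp add: lead_coeff_prod)
  have degC: "degree C = m"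
    unfolding C_def m_def using finite_roots card_roots by (subst degree_prod_eq_sum_degree) auto
  have C: "C = (\<Prod>x\<in>#image_mset (ev f) (mset_set roots). [:- x, 1:])"
    by (simp add: C_def prod_unfold_prod_mset image_mset.compositionality comp_def)
  have Cint: "val_ge 0 (coeff C i)" for i
    unfolding C using assms finite_roots
    by (intro val_ge_0_coeff_prod_linear) (auto simp: integral_def)
  obtain c where c: "\<And>i. \<pi> (coeff C i) = fps_to_fls (c i)" using pi(4)[OF Cint] by metis
  define r where "r = (\<lambda>i. f ^ i mod G)"
  note Gne = G_nonzero
  have r: "G dvd f ^ i - r i" for i by (simp add: r_def minus_mod_eq_mult_div)
  then have evr: "ev (r i) \<gamma> = ev f \<gamma> ^ i" if "\<gamma> \<in> roots" for i \<gamma>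
    using that G_dvd_iff by (metis ev_diff ev_power right_minus_eq)
  define Q where "Q = (\<Sum>i\<le>m. smult (coeff C i) (map_poly emb (r i)))"
  have polyC: "poly C z = (\<Sum>i\<le>m. coeff C i * z ^ i)" for z
    by (simp add: poly_altdef degC)
  have "Q = 0"
  proof (rule ccontr)
    assume ne: "Q \<noteq> 0"
    have "degree (map_poly emb (r i)) < m" for i
    proof -
      have "degree (r i) < m" using degree_mod_less[OF Gne, of "f ^ i"] degree_pos by (auto simp: r_def m_def)
      moreover have "degree (map_poly emb (r i)) \<le> degree (r i)"
        by (rule degree_le) (simp add: e.coeff_map coeff_eq_0 e.hom_zero)
      ultimately show ?thesis by simp
    qed
    then have "degree Q < m" unfolding Q_def using degree_pos
      by (intro degree_sum_less) (auto simp: m_def intro: le_less_trans[OF degree_smult_le])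
    moreover have "poly Q \<gamma> = 0" if "\<gamma> \<in> roots" for \<gamma>
    proof -
      have "poly Q \<gamma> = poly C (ev f \<gamma>)"
        using evr[OF that] by (simp add: Q_def poly_sum polyC ev_def[symmetric])
      also have "\<dots> = 0" using that finite_roots by (auto simp: C_def poly_prod)
      finally show ?thesis .
    qed
    then have "card roots \<le> card {x. poly Q x = 0}"
      by (intro card_mono poly_roots_finite[OF ne]) auto
    ultimately show False using card_poly_roots_bound[OF ne] card_roots by (simp add: m_def)
  qed
  have "(\<Sum>i\<le>m. smult (fps_to_fls (c i)) (r i)) = 0"
  proof (rule poly_eqI)
    fix j
    have "0 = \<pi> (coeff Q j)" by (simp add: \<open>Q = 0\<close> pi0)
    also have "\<dots> = (\<Sum>i\<le>m. \<pi> (emb (coeff (r i) j) * coeff C i))"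
      by (simp add: Q_def coeff_sum e.coeff_map pisum mult.commute)
    also have "\<dots> = coeff (\<Sum>i\<le>m. smult (fps_to_fls (c i)) (r i)) j"
      by (simp only: pi(2) c) (simp add: coeff_sum mult.commute)
    finally show "coeff (\<Sum>i\<le>m. smult (fps_to_fls (c i)) (r i)) j = coeff 0 j" by simp
  qed
  then have "(\<Sum>i\<le>m. smult (fps_to_fls (c i)) (f ^ i)) = (\<Sum>i\<le>m. smult (fps_to_fls (c i)) (f ^ i - r i))"
    by (simp add: smult_diff_right sum_subtractf)
  then have "G dvd (\<Sum>i\<le>m. smult (fps_to_fls (c i)) (f ^ i))"
    by (simp only:) (intro dvd_sum dvd_smult r)
  moreover have "fps_to_fls (c m) = 1" using c[of m] lc degC pi(3) by simp
  moreover have "laurent_poly [:c i:] = [:fps_to_fls (c i):]" for i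
    by (rule poly_eqI) (simp add: coeff_pCons split: nat.splits)
  ultimately have "G dvd f ^ m + (\<Sum>i<m. laurent_poly [:c i:] * f ^ i)"
    by (simp add: lessThan_Suc_atMost[symmetric] add.commute)
  then show ?thesis unfolding m_def by blast
qed

lemma equation_imp_integral:
  assumes "G dvd f ^ n + (\<Sum>i<n. laurent_poly (c i) * f ^ i)"
  shows "integral f"
  unfolding integral_def
proof
  fix \<gamma> assume g: "\<gamma> \<in> roots"
  have "ev f \<gamma> ^ n + (\<Sum>i<n. ev (laurent_poly (c i)) \<gamma> * ev f \<gamma> ^ i) = 0"
    using assms g unfolding G_dvd_iff by (auto simp: ev_simps)
  then show "val_ge 0 (ev f \<gamma>)"
    by (rule val_ge_0_root[rotated]) (rule ev_laurent_poly_integral[OF root_integral[OF g]])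
qed

end


section \<open>Monic polynomials of large valuation\<close>

text \<open>For \<open>y\<close> in \<open>S\<close>, the quotient \<open>(q(x) - q(y)) / (x - y)\<close> is a monic polynomial in \<open>x\<close> of smaller
degree, so \<open>y\<close> can be discarded. Each division costs at most \<open>N\<close>, a bound for the valuations of
the differences of points of \<open>S\<close>. It follows that integrality exponents are bounded in each degree.\<close>

lemma monic_val_bound:
  fixes S :: "'a::field puiseux set"
  assumes "finite S"
  obtains N where "\<And>q r. lead_coeff q = 1 \<Longrightarrow> degree q < card S \<Longrightarrow>
    (\<And>x. x \<in> S \<Longrightarrow> val_ge r (poly q x)) \<Longrightarrow> r \<le> of_nat (degree q) * N"
proof -
  let ?D = "(\<lambda>(x, y). inverse (x - y)) ` (S \<times> S)"
  have lower: "\<exists>N. \<forall>f\<in>D. val_ge (- N) f" if "finite D" for D :: "'a puiseux set"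
    using that
  proof (induction D rule: finite_induct)
    case (insert f D)
    then obtain N where N: "\<forall>f\<in>D. val_ge (- N) f" by blast
    obtain r where r: "val_ge r f" using val_ge_ex by blast
    have "val_ge (- max N (- r)) h" if "h \<in> insert f D" for h
      using that N r val_ge_mono[of r f "- max N (- r)"] val_ge_mono[of "- N" h "- max N (- r)"]
      by auto
    then show ?case by blast
  qed simp
  have "finite ?D" using assms by simp
  from lower[OF this] obtain N where "\<forall>f\<in>?D. val_ge (- N) f" ..
  then have N: "val_ge (- N) (inverse (x - y))" if "x \<in> S" "y \<in> S" for x y using that by simp
  have "r \<le> of_nat k * N" if "lead_coeff q = 1" "degree q = k" "k < card T" "T \<subseteq> S"
    "\<And>x. x \<in> T \<Longrightarrow> val_ge r (poly q x)" for q r k T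
    using that
  proof (induction k arbitrary: q r T)
    case 0
    have "T \<noteq> {}" using 0(3) by auto
    then obtain x where "x \<in> T" by blast
    have "q = 1" using 0(1,2) by (rule monic_degree_0)
    with 0(5)[OF \<open>x \<in> T\<close>] have "val_ge r (1 :: 'a puiseux)" by simp
    then have "\<not> 0 < r" by (auto simp: val_ge_def pcoeff_one)
    then show ?case by simp
  next
    case (Suc k)
    have "T \<noteq> {}" using Suc.prems(3) by auto
    then obtain y where y: "y \<in> T" by blast
    have "poly (q - [:poly q y:]) y = 0" by simp
    then have "[:- y, 1:] dvd q - [:poly q y:]" by (rule poly_eq_0_iff_dvd[THEN iffD1])
    then obtain h where h: "q - [:poly q y:] = [:- y, 1:] * h" by (rule dvdE)
    have "degree (q - [:poly q y:]) = Suc k" "lead_coeff (q - [:poly q y:]) = 1"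
    proof -
      have c: "coeff (q - [:poly q y:]) i = coeff q i" if "i > 0" for i
        using that by (simp add: coeff_pCons split: nat.splits)
      show d: "degree (q - [:poly q y:]) = Suc k"
      proof (rule antisym)
        show "degree (q - [:poly q y:]) \<le> Suc k"
          by (rule degree_le) (use Suc.prems(2) c in \<open>auto simp: coeff_eq_0\<close>)
        show "Suc k \<le> degree (q - [:poly q y:])"
          by (rule le_degree) (use Suc.prems(1,2) c in simp)
      qed
      show "lead_coeff (q - [:poly q y:]) = 1" using Suc.prems(1,2) c d by simp
    qed
    moreover from this have "h \<noteq> 0" using h by auto
    then have "degree ([:- y, 1:] * h) = Suc (degree h)" by (subst degree_mult_eq) auto
    ultimately have "degree h = k" "lead_coeff h = 1"
      unfolding h lead_coeff_mult by auto
    moreover have "k < card (T - {y})" using y Suc.prems(3) by (simp add: card_Diff_singleton)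
    moreover have "val_ge (r - N) (poly h x)" if x: "x \<in> T - {y}" for x
    proof -
      have "poly q x - poly q y = (x - y) * poly h x"
        using arg_cong[OF h, of "\<lambda>p. poly p x"] by (simp add: algebra_simps)
      moreover have "x - y \<noteq> 0" using x by simp
      ultimately have "poly h x = inverse (x - y) * (poly q x - poly q y)"
        by (simp add: mult.assoc[symmetric])
      moreover have "val_ge (- N) (inverse (x - y))" using x y Suc.prems(4) by (intro N) auto
      moreover have "val_ge r (poly q x - poly q y)" using x y by (intro val_ge_diff Suc.prems(5)) auto
      ultimately show ?thesis by (auto intro!: val_ge_mult'[of "- N" _ r])
    qed
    ultimately have "r - N \<le> of_nat k * N"
      using Suc.prems(4) by (intro Suc.IH[of h "T - {y}" "r - N"]) auto
    then show ?case by (simp add: algebra_simps)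
  qed
  from this[OF _ refl _ subset_refl] show ?thesis by (rule that)
qed

lemma monic_division:
  fixes f a :: "'a::idom poly"
  assumes "lead_coeff a = 1"
  obtains q r where "f = a * q + r" "r = 0 \<or> degree r < degree a"
proof -
  have "a \<noteq> 0" using assms by auto
  obtain q r where qr: "pseudo_divmod f a = (q, r)" by fastforce
  from pseudo_divmod[OF \<open>a \<noteq> 0\<close> qr] assms show ?thesis using that by simp
qed

lemma monic_plus_lower:
  fixes a r :: "'a::idom poly"
  assumes "lead_coeff a = 1" "r = 0 \<or> degree r < degree a"
  shows "degree (a + smult c r) = degree a" and "lead_coeff (a + smult c r) = 1"
proof -
  have *: "coeff r i = 0" if "i \<ge> degree a" for i
    using assms(2) that by (auto simp: coeff_eq_0)
  show d: "degree (a + smult c r) = degree a"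
  proof (rule antisym)
    show "degree (a + smult c r) \<le> degree a" by (rule degree_le) (use * in \<open>auto simp: coeff_eq_0\<close>)
    show "degree a \<le> degree (a + smult c r)" by (rule le_degree) (use * assms(1) in simp)
  qed
  show "lead_coeff (a + smult c r) = 1" unfolding d using * assms(1) by simp
qed

text \<open>\<open>P\<close> has reduction of degree \<open>t\<close> modulo \<open>X\<close>, although its own degree may be larger. To improve a
congruence \<open>P U \<equiv> A\<close> modulo \<open>X\<^bsup>n+1\<^esup>\<close>, with error \<open>X\<^bsup>n+1\<^esup> R\<close>, divide \<open>R = A C + S\<close> by
the monic \<open>A\<close>: multiplying \<open>U\<close> by \<open>1 - X\<^bsup>n+1\<^esup> C\<close> removes the multiple of \<open>A\<close>, and the remainder
\<open>S\<close> of low degree is absorbed into \<open>A\<close>.\<close>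

lemma weierstrass_preparation_approx:
  fixes P :: "'a::field fps poly"
  assumes red: "fps_nth (coeff P t) 0 \<noteq> 0" "\<And>i. i > t \<Longrightarrow> fps_nth (coeff P i) 0 = 0"
  shows "\<exists>U A R. P * U = A + smult (fps_X ^ Suc n) R \<and> lead_coeff A = 1 \<and> degree A = t"
proof (induction n)
  case 0
  define u where "u = inverse (coeff P t)"
  define Q where "Q = smult u P"
  have PQ: "P * [:u:] = Q" by (simp add: Q_def)
  have cQ: "coeff Q t = 1" using red(1) by (simp add: Q_def u_def inverse_mult_eq_1)
  have Q0: "fps_nth (coeff Q i) 0 = 0" if "i > t" for i
    using red(2)[OF that] by (simp add: Q_def)
  obtain A where A: "\<And>i. coeff A i = (if i \<le> t then coeff Q i else 0)"
    using poly_of_coeff_fun[of t "coeff Q"] by blast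
  have degA: "degree A = t" by (intro antisym degree_le le_degree) (use A cQ in auto)
  obtain R where R: "\<And>i. coeff R i =
      (if i \<le> degree Q then (if i \<le> t then 0 else fps_shift 1 (coeff Q i)) else 0)"
    using poly_of_coeff_fun[of "degree Q" "\<lambda>i. if i \<le> t then 0 else fps_shift 1 (coeff Q i)"] by blast
  have "Q = A + smult (fps_X ^ Suc 0) R"
  proof (rule poly_eqI)
    fix i
    have shift: "fps_X * fps_shift 1 (coeff Q i) = coeff Q i" if "i > t"
    proof (rule fps_ext)
      fix n show "fps_nth (fps_X * fps_shift 1 (coeff Q i)) n = fps_nth (coeff Q i) n"
        using Q0[OF that] by (cases n) simp_all
    qed
    show "coeff Q i = coeff (A + smult (fps_X ^ Suc 0) R) i"
    proof (cases "i \<le> t")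
      case False
      then show ?thesis using shift by (cases "i \<le> degree Q") (simp_all add: A R coeff_eq_0)
    qed (simp add: A R)
  qed
  with PQ have "P * [:u:] = A + smult (fps_X ^ Suc 0) R" by (rule trans)
  moreover have "lead_coeff A = 1" using degA A cQ by simp
  ultimately show ?case using degA by blast
next
  case (Suc n)
  then obtain U A R where IH: "P * U = A + smult (fps_X ^ Suc n) R" "lead_coeff A = 1" "degree A = t"
    by blast
  obtain C S where S: "R = A * C + S" "S = 0 \<or> degree S < degree A" by (rule monic_division[OF IH(2)])
  let ?X = "fps_X ^ Suc n :: 'a fps"
  have "P * (U * (1 - smult ?X C)) = (A + smult ?X R) * (1 - smult ?X C)"
    by (simp only: IH(1)[symmetric] mult.assoc)
  also have "\<dots> = (A + smult ?X S) - smult (?X * ?X) (R * C)"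
    by (simp add: S(1) algebra_simps smult_add_right smult_diff_right)
  also have "?X * ?X = fps_X ^ Suc (Suc n) * fps_X ^ n"
    by (simp only: power_add[symmetric]) simp
  finally have "P * (U * (1 - smult ?X C)) =
      (A + smult ?X S) + smult (fps_X ^ Suc (Suc n)) (smult (- (fps_X ^ n)) (R * C))"
    by simp
  then show ?case
    using monic_plus_lower[OF IH(2) S(2), of ?X] IH(3)
    by (intro exI[of _ "U * (1 - smult ?X C)"] exI[of _ "A + smult ?X S"]
        exI[of _ "smult (- (fps_X ^ n)) (R * C)"] conjI) simp_all
qed

text \<open>Clearing denominators by the smallest power of \<open>X\<close>. If no power is needed, the leading coefficient 1
is the one that survives modulo \<open>X\<close>.\<close>

lemma laurent_poly_primitive_multiple:
  fixes q :: "'a::field fls poly"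
  assumes "lead_coeff q = 1"
  obtains s P t where "laurent_poly P = smult (fls_X_intpow (int s)) q"
    "t \<le> degree q" "fps_nth (coeff P t) 0 \<noteq> 0" "\<And>i. i > t \<Longrightarrow> fps_nth (coeff P i) 0 = 0"
proof -
  define d where "d = (\<lambda>i. nat (- fls_subdegree (coeff q i)))"
  define s where "s = Max (d ` {..degree q})"
  have s: "d i \<le> s" if "i \<le> degree q" for i unfolding s_def using that by (intro Max_ge) auto
  have low: "fls_nth (coeff q i) k = 0" if "k < - int s" for i k
  proof (cases "i \<le> degree q")
    case True
    then have "k < fls_subdegree (coeff q i)" using s[OF True] that by (simp add: d_def)
    then show ?thesis by simp
  qed (simp add: coeff_eq_0)
  have "\<exists>i\<le>degree q. fls_nth (coeff q i) (- int s) \<noteq> 0"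
  proof (cases "s = 0")
    case True
    then show ?thesis using assms by (intro exI[of _ "degree q"]) simp
  next
    case False
    have "s \<in> d ` {..degree q}" unfolding s_def by (intro Max_in) auto
    then obtain i where i: "i \<le> degree q" "s = d i" by blast
    with False have "fls_subdegree (coeff q i) = - int s" by (simp add: d_def)
    moreover from this False have "coeff q i \<noteq> 0" by auto
    ultimately show ?thesis using i(1) nth_fls_subdegree_nonzero by metis
  qed
  then obtain i0 where i0: "i0 \<le> degree q" "fls_nth (coeff q i0) (- int s) \<noteq> 0" by blast
  define I where "I = {i. i \<le> degree q \<and> fls_nth (coeff q i) (- int s) \<noteq> 0}"
  have I: "finite I" "i0 \<in> I" using i0 by (simp_all add: I_def)
  define t where "t = Max I"
  have t: "t \<in> I" unfolding t_def using I by (intro Max_in) auto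
  have t': "fls_nth (coeff q i) (- int s) = 0" if "i > t" for i
  proof (rule ccontr)
    assume *: "fls_nth (coeff q i) (- int s) \<noteq> 0"
    then have "i \<le> degree q" by (metis coeff_eq_0 fls_zero_nth not_le)
    with * have "i \<le> t" unfolding t_def using I by (intro Max_ge) (simp_all add: I_def)
    with that show False by simp
  qed
  have nth: "fls_nth (coeff (smult (fls_X_intpow (int s)) q) i) k = fls_nth (coeff q i) (k - int s)" for i k
    by (simp add: fls_X_intpow_times_conv_shift)
  obtain P where P: "smult (fls_X_intpow (int s)) q = laurent_poly P"
  proof (rule laurent_poly_if_coeffs_integral)
    fix i
    show "coeff (smult (fls_X_intpow (int s)) q) i =
        fps_to_fls (fls_regpart (coeff (smult (fls_X_intpow (int s)) q) i))"
      by (rule fls_eqI) (simp only: nth fps_to_fls_nth fls_regpart_nth, auto simp: low)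
  qed blast
  have cP: "fps_nth (coeff P i) 0 = fls_nth (coeff q i) (- int s)" for i
    using nth[of i 0] by (simp only: P coeff_laurent_poly) simp
  show ?thesis
    using that[of P s t] P t t' by (simp add: cP I_def)
qed

context squarefree_over_power_series
begin

lemma ev_monom_fps_X: "ev (laurent_poly (smult (fps_X ^ n) R)) \<gamma> = puiseux_monom (of_nat n) * ev (laurent_poly R) \<gamma>"
proof -
  have "fps_to_fls (fps_X ^ n :: 'k fps) = fls_X_intpow (int n)"
    by (rule fls_eqI) (auto simp: fps_X_power_nth)
  then have "laurent_poly (smult (fps_X ^ n) R) = smult (fls_X_intpow (int n)) (laurent_poly R)"
    by (intro poly_eqI) (simp add: fls_times_fps_to_fls)
  then show ?thesis by (simp add: ev_smult emb_X_intpow)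
qed

text \<open>Let \<open>P = X\<^sup>s q\<close> be primitive with reduction of degree \<open>t\<close>. Weierstrass preparation gives a monic
\<open>A\<close> over \<open>K[[X]]\<close> of degree \<open>t\<close> with \<open>A \<equiv> P U\<close> modulo a power of \<open>X\<close> that is too high to
matter. The values \<open>U(\<gamma>)\<close> are integral, hence \<open>A(\<gamma>)\<close> has valuation at least \<open>r\<close> because
\<open>q(\<gamma>)\<close> does, and multiplying by a power of \<open>Y\<close> restores the degree because \<open>\<gamma>\<close> is integral.\<close>

lemma integral_coefficients_suffice:
  assumes q: "lead_coeff q = 1" and val: "\<And>\<gamma>. \<gamma> \<in> roots \<Longrightarrow> val_ge r (ev q \<gamma>)"
  obtains q' where "lead_coeff q' = 1" "degree q' = degree q"
    "\<And>\<gamma>. \<gamma> \<in> roots \<Longrightarrow> val_ge r (ev (laurent_poly q') \<gamma>)"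
proof -
  obtain s P t where P: "laurent_poly P = smult (fls_X_intpow (int s)) q" "t \<le> degree q"
    "fps_nth (coeff P t) 0 \<noteq> 0" "\<And>i. i > t \<Longrightarrow> fps_nth (coeff P i) 0 = 0"
    by (rule laurent_poly_primitive_multiple[OF q]) blast
  \<comment> \<open>Any precision \<open>n + 1 \<ge> r\<close> suffices: the error term then has valuation at least \<open>r\<close>.\<close>
  define n where "n = nat \<lceil>r\<rceil>"
  have n: "r \<le> of_nat (Suc n)" unfolding n_def by (rule order_trans[OF of_nat_ceiling]) simp
  obtain U A R where A: "P * U = A + smult (fps_X ^ Suc n) R" "lead_coeff A = 1" "degree A = t"
    using weierstrass_preparation_approx[OF P(3,4), of n] by blast
  \<comment> \<open>The factor \<open>Y\<close> to the power \<open>degree q - t\<close> stands for the roots of negative valuation, moved to 0.\<close>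
  define q' where "q' = monom 1 (degree q - t) * A"
  have "A \<noteq> 0" using A(2) by auto
  then have "degree q' = degree q"
    using A(3) P(2) by (simp add: q'_def degree_mult_eq degree_monom_eq monom_eq_0_iff)
  moreover have "lead_coeff q' = 1"
    unfolding q'_def lead_coeff_mult using A(2) by (simp add: degree_monom_eq)
  moreover have "val_ge r (ev (laurent_poly q') \<gamma>)" if g: "\<gamma> \<in> roots" for \<gamma>
  proof -
    note int = ev_laurent_poly_integral[OF root_integral[OF g]]
    have "A = P * U - smult (fps_X ^ Suc n) R" using A(1) by simp
    then have "ev (laurent_poly A) \<gamma> = ev (laurent_poly U) \<gamma> * (puiseux_monom (of_nat s) * ev q \<gamma>) -
        ev (laurent_poly R) \<gamma> * puiseux_monom (of_nat (Suc n))"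
      by (simp only: lp.hom_diff lp.hom_mult ev_diff ev_mult ev_monom_fps_X P(1) ev_smult emb_X_intpow)
        (simp add: mult_ac)
    moreover have "val_ge r (puiseux_monom (of_nat s) * ev q \<gamma>)"
      using val[OF g] by (simp add: val_ge_monom_mult) (erule val_ge_mono, simp)
    moreover have "val_ge r (puiseux_monom (of_nat (Suc n)) :: 'l puiseux)"
      using val_ge_puiseux_monom n by (rule val_ge_mono)
    ultimately have "val_ge r (ev (laurent_poly A) \<gamma>)"
      using int by (auto intro!: val_ge_diff val_ge_mult0)
    then show ?thesis
      using int unfolding q'_def lp.hom_mult ev_mult by (intro val_ge_mult0)
  qed
  ultimately show ?thesis using that by blast
qed

section \<open>Integrality exponents\<close>

lemma ev_some_nonzero:
  assumes "lead_coeff q = 1" "degree q < degree g"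
  obtains \<gamma> where "\<gamma> \<in> roots" "ev (laurent_poly q) \<gamma> \<noteq> 0"
proof -
  have "\<not> G dvd laurent_poly q"
  proof
    assume "G dvd laurent_poly q"
    moreover have "laurent_poly q \<noteq> 0" using assms(1) laurent_poly_inject[of q 0] by (auto simp: lp.hom_zero)
    ultimately have "degree G \<le> degree (laurent_poly q)" by (rule dvd_imp_degree_le)
    with assms(2) show False by simp
  qed
  then show ?thesis using that by (auto simp: G_dvd_iff)
qed

text \<open>A monic polynomial of degree below that of \<open>g\<close> does not vanish at all roots of \<open>g\<close>, so the minimum
defining the integrality exponent is finite.\<close>

lemma le_integrality_exponent_iff:
  assumes "lead_coeff q = 1" "degree q < degree g"
  shows "n \<le> integrality_exponent \<iota> g q \<longleftrightarrow> (\<forall>\<gamma>\<in>roots. val_ge (of_int n) (ev (laurent_poly q) \<gamma>))"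
proof -
  let ?V = "(\<lambda>\<gamma>. pval (poly (puiseux_poly \<iota> q) \<gamma>)) ` roots"
  have fin: "finite ?V" "?V \<noteq> {}" using finite_roots roots_nonempty by auto
  have ev: "poly (puiseux_poly \<iota> q) \<gamma> = ev (laurent_poly q) \<gamma>" for \<gamma> by (simp add: ev_def puiseux_poly_eq)
  have iff: "Fin r \<le> Min ?V \<longleftrightarrow> (\<forall>\<gamma>\<in>roots. val_ge r (ev (laurent_poly q) \<gamma>))" for r
    using fin by (simp add: Min_ge_iff val_ge_pval ev)
  obtain \<gamma> where g: "\<gamma> \<in> roots" "ev (laurent_poly q) \<gamma> \<noteq> 0" by (rule ev_some_nonzero[OF assms])
  obtain r where "pval (ev (laurent_poly q) \<gamma>) = Fin r" by (rule pcoeff_lowest_ex[OF g(2)])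
  then have "Min ?V \<le> Fin r" using fin(1) g(1) by (intro Min_le rev_image_eqI[OF g(1)]) (simp_all add: ev)
  moreover have "Min ?V \<noteq> Minf"
  proof -
    have "Min ?V \<in> ?V" by (rule Min_in[OF fin])
    then show ?thesis by (auto simp: pval_def split: if_splits)
  qed
  ultimately obtain w where w: "Min ?V = Fin w" by (cases "Min ?V") auto
  show ?thesis using iff[of "of_int n"]
    by (simp add: integrality_exponent_def valuation_at_def w le_floor_iff)
qed

text \<open>For \<open>q\<close> monic of degree below that of \<open>g\<close>, this says that \<open>e\<close> is the exponent of \<open>q\<close> and maximal in its degree,
expressed by lower bounds on values so that neither a minimum nor a maximum occurs.\<close>

definition integrality_optimal :: "'k fps poly \<Rightarrow> int \<Rightarrow> bool" where
  "integrality_optimal q e \<longleftrightarrow> (\<forall>\<gamma>\<in>roots. val_ge (of_int e) (ev (laurent_poly q) \<gamma>)) \<and>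
    (\<forall>q' n. lead_coeff q' = 1 \<longrightarrow> degree q' = degree q \<longrightarrow>
      (\<forall>\<gamma>\<in>roots. val_ge (of_int n) (ev (laurent_poly q') \<gamma>)) \<longrightarrow> n \<le> e)"

lemma integrality_exponent_bounded:
  obtains N where "\<And>q. lead_coeff q = 1 \<Longrightarrow> degree q = d \<Longrightarrow> d < degree g \<Longrightarrow> integrality_exponent \<iota> g q \<le> N"
proof -
  obtain N where N: "\<And>q r. lead_coeff q = 1 \<Longrightarrow> degree q < card roots \<Longrightarrow>
    (\<And>x. x \<in> roots \<Longrightarrow> val_ge r (poly q x)) \<Longrightarrow> r \<le> of_nat (degree q) * N"
    by (rule monic_val_bound[OF finite_roots]) blast
  have "integrality_exponent \<iota> g q \<le> \<lfloor>of_nat d * N\<rfloor>" if q: "lead_coeff q = 1" "degree q = d" "d < degree g" for q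
  proof -
    let ?n = "integrality_exponent \<iota> g q"
    have lq: "lead_coeff (laurent_poly q) = 1" using q(1) by simp
    have "\<forall>\<gamma>\<in>roots. val_ge (of_int ?n) (ev (laurent_poly q) \<gamma>)"
      using le_integrality_exponent_iff[of q ?n] q by simp
    then have "of_int ?n \<le> of_nat (degree (map_poly emb (laurent_poly q))) * N"
      using q e.degree_map_poly_monic[OF lq] card_roots by (intro N) (auto simp: ev_def)
    then show ?thesis using q(2) e.degree_map_poly_monic[OF lq] by (simp add: le_floor_iff)
  qed
  then show ?thesis by (rule that)
qed

lemma max_integrality_exponent:
  assumes "d < degree g"
  shows "\<exists>q. lead_coeff q = 1 \<and> degree q = d \<and> max_integrality_exponent \<iota> g d = integrality_exponent \<iota> g q"
    and "lead_coeff q = 1 \<Longrightarrow> degree q = d \<Longrightarrow> integrality_exponent \<iota> g q \<le> max_integrality_exponent \<iota> g d"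
proof -
  let ?P = "\<lambda>q :: 'k fps poly. lead_coeff q = 1 \<and> degree q = d"
  let ?e = "integrality_exponent \<iota> g"
  obtain N where N: "\<And>q. ?P q \<Longrightarrow> ?e q \<le> N"
    using integrality_exponent_bounded[of d] assms by metis
  have "?P (monom 1 d)" by (simp add: degree_monom_eq)
  \<comment> \<open>The exponents are bounded by \<open>N\<close>, so minimizing the distance to \<open>N\<close> yields a maximum.\<close>
  from ex_has_least_nat[of ?P, OF this, of "\<lambda>q. nat (N - ?e q)"]
  obtain q0 where q0: "?P q0" "\<And>q. ?P q \<Longrightarrow> nat (N - ?e q0) \<le> nat (N - ?e q)" by blast
  have le: "?e q \<le> ?e q0" if "?P q" for q
    using N[OF that] N[OF q0(1)] q0(2)[OF that] by linarith
  have "max_integrality_exponent \<iota> g d = ?e q0"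
    unfolding max_integrality_exponent_def using q0(1) le by (intro Greatest_equality) auto
  with q0(1) le show "\<exists>q. lead_coeff q = 1 \<and> degree q = d \<and> max_integrality_exponent \<iota> g d = ?e q"
    and "lead_coeff q = 1 \<Longrightarrow> degree q = d \<Longrightarrow> ?e q \<le> max_integrality_exponent \<iota> g d" by auto
qed

lemma integrality_optimal_iff:
  assumes "lead_coeff q = 1" "degree q < degree g"
  shows "integrality_optimal q e \<longleftrightarrow>
    e = integrality_exponent \<iota> g q \<and> integrality_exponent \<iota> g q = max_integrality_exponent \<iota> g (degree q)"
proof -
  let ?e = "integrality_exponent \<iota> g"
  have E: "(\<forall>\<gamma>\<in>roots. val_ge (of_int n) (ev (laurent_poly q') \<gamma>)) \<longleftrightarrow> n \<le> ?e q'"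
    if "lead_coeff q' = 1" "degree q' = degree q" for q' n
    using le_integrality_exponent_iff[of q' n] that assms(2) by simp
  have "integrality_optimal q e \<longleftrightarrow> e \<le> ?e q \<and>
      (\<forall>q' n. lead_coeff q' = 1 \<longrightarrow> degree q' = degree q \<longrightarrow> n \<le> ?e q' \<longrightarrow> n \<le> e)"
    unfolding integrality_optimal_def using E[OF assms(1) refl, of e] E
    by (intro conj_cong all_cong1 imp_cong) auto
  also have "\<dots> \<longleftrightarrow> e = ?e q \<and> ?e q = max_integrality_exponent \<iota> g (degree q)"
  proof
    assume L: "e \<le> ?e q \<and>
      (\<forall>q' n. lead_coeff q' = 1 \<longrightarrow> degree q' = degree q \<longrightarrow> n \<le> ?e q' \<longrightarrow> n \<le> e)"
    obtain q0 where q0: "lead_coeff q0 = 1" "degree q0 = degree q"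
      "max_integrality_exponent \<iota> g (degree q) = ?e q0"
      using max_integrality_exponent(1)[OF assms(2)] by blast
    from L q0 have "?e q0 \<le> e" by blast
    moreover have "?e q \<le> ?e q0"
      using max_integrality_exponent(2)[OF assms(2) assms(1) refl] q0(3) by simp
    ultimately show "e = ?e q \<and> ?e q = max_integrality_exponent \<iota> g (degree q)"
      using L q0(3) by linarith
  next
    assume R: "e = ?e q \<and> ?e q = max_integrality_exponent \<iota> g (degree q)"
    show "e \<le> ?e q \<and>
      (\<forall>q' n. lead_coeff q' = 1 \<longrightarrow> degree q' = degree q \<longrightarrow> n \<le> ?e q' \<longrightarrow> n \<le> e)"
    proof (intro conjI allI impI)
      fix q' n assume "lead_coeff q' = 1" "degree q' = degree q" "n \<le> ?e q'"
      with max_integrality_exponent(2)[OF assms(2), of q'] R show "n \<le> e" by linarith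
    qed (use R in simp)
  qed
  finally show ?thesis .
qed

end


section \<open>Triangular bases\<close>

text \<open>Elimination from the top: the vanishing coefficients kill \<open>F (n - 1), \<dots>, F (d + 1)\<close> one after the other, and
then only the term with index \<open>d\<close> reaches degree \<open>d\<close>.\<close>

lemma triangular_combination_coeff:
  fixes b :: "nat \<Rightarrow> 'a::idom poly"
  assumes "\<And>j. j < n \<Longrightarrow> degree (b j) = j"
    and "d < n" "\<And>i. d < i \<Longrightarrow> i < n \<Longrightarrow> coeff (\<Sum>j<n. smult (F j) (b j)) i = 0"
    and "\<And>j. j < n \<Longrightarrow> lead_coeff (b j) \<noteq> 0"
  shows "coeff (\<Sum>j<n. smult (F j) (b j)) d = F d * lead_coeff (b d)"
  using assms
proof (induction n)
  case (Suc n)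
  have top: "coeff (\<Sum>j<n. smult (F j) (b j)) n = 0"
    unfolding coeff_sum using Suc.prems(1) by (intro sum.neutral ballI) (simp add: coeff_eq_0)
  show ?case
  proof (cases "d = n")
    case True
    then show ?thesis using top Suc.prems(1)[of n] by simp
  next
    case False
    then have "d < n" using Suc.prems(2) by simp
    then have "coeff (\<Sum>j<Suc n. smult (F j) (b j)) n = 0" using Suc.prems(3)[of n] by simp
    moreover have "coeff (b n) n \<noteq> 0" using Suc.prems(1,4)[of n] by simp
    ultimately have "F n = 0" using top by simp
    then have eq: "(\<Sum>j<Suc n. smult (F j) (b j)) = (\<Sum>j<n. smult (F j) (b j))" by simp
    show ?thesis unfolding eq
      by (rule Suc.IH) (use Suc.prems \<open>d < n\<close> eq in \<open>auto simp del: sum.lessThan_Suc\<close>)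
  qed
qed simp

context squarefree_over_power_series
begin

text \<open>The representative \<open>q/X\<^sup>n\<close> of \<open>q(x, y)/x\<^sup>n\<close>.\<close>

definition scaled :: "'k fps poly \<Rightarrow> int \<Rightarrow> 'k fls poly" where
  "scaled q n = smult (fls_X_intpow (- n)) (laurent_poly q)"

lemma coeff_scaled_top: "lead_coeff q = 1 \<Longrightarrow> coeff (scaled q n) (degree q) = fls_X_intpow (- n)"
  by (simp add: scaled_def)

lemma degree_scaled: "degree (scaled q n) = degree q"
  by (simp add: scaled_def fls_shift_eq0_iff)

lemma lead_coeff_scaled: "lead_coeff q = 1 \<Longrightarrow> lead_coeff (scaled q n) = fls_X_intpow (- n)"
  using coeff_scaled_top[of q n] by (simp add: degree_scaled)

lemma lead_coeff_scaled_nonzero: "lead_coeff q = 1 \<Longrightarrow> lead_coeff (scaled q n) \<noteq> 0"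
  by (simp only: lead_coeff_scaled fls_X_intpow_nonzero not_False_eq_True)

lemma integral_scaled_iff:
  "integral (scaled q n) \<longleftrightarrow> (\<forall>\<gamma>\<in>roots. val_ge (of_int n) (ev (laurent_poly q) \<gamma>))"
  using emb_X_intpow[of "- n"] by (simp add: integral_def scaled_def ev_smult val_ge_monom_mult)

lemma integral_diff: "integral f \<Longrightarrow> integral h \<Longrightarrow> integral (f - h)"
  by (simp add: integral_def ev_diff val_ge_diff)

lemma integral_smult: "integral f \<Longrightarrow> integral (smult (fps_to_fls c) f)"
  by (simp add: integral_def ev_smult val_ge_mult0 val_ge_emb_fps)

lemma integrality_optimal_one: "integrality_optimal 1 0"
proof -
  obtain \<gamma> where "\<gamma> \<in> roots" using roots_nonempty by blast
  have "n \<le> 0" if q: "lead_coeff q = 1" "degree q = 0"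
    and "\<forall>\<gamma>\<in>roots. val_ge (of_int n) (ev (laurent_poly q) \<gamma>)" for q n
  proof -
    have "q = 1" by (rule monic_degree_0[OF q])
    then have "val_ge (of_int n) (1 :: 'l puiseux)"
      using that(3) \<open>\<gamma> \<in> roots\<close> by (auto simp: lp.hom_one ev_1)
    then have "\<not> (0 :: rat) < of_int n" by (auto simp: val_ge_def pcoeff_one dest: spec[of _ 0])
    then show ?thesis by simp
  qed
  moreover have "\<forall>\<gamma>\<in>roots. val_ge (of_int 0) (ev (laurent_poly 1) \<gamma>)"
    by (simp add: lp.hom_one ev_1 val_ge_1)
  ultimately show ?thesis unfolding integrality_optimal_def degree_1 by blast
qed

text \<open>Dividing \<open>f\<close> by its leading coefficient \<open>a\<close> gives a monic polynomial whose values have valuation at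
least \<open>-v(a)\<close>; it may be replaced by one over \<open>K[[X]]\<close>, to which maximality applies.\<close>

lemma leading_subdegree_bound:
  assumes opt: "integrality_optimal q n" and f: "integral f" "degree f = degree q" "f \<noteq> 0"
  shows "- fls_subdegree (lead_coeff f) \<le> n"
proof -
  let ?a = "lead_coeff f"
  have a: "?a \<noteq> 0" using f(3) by simp
  have lc: "lead_coeff (smult (inverse ?a) f) = 1" using a by simp
  have "val_ge (of_int (- fls_subdegree ?a)) (emb (inverse ?a))"
    unfolding val_ge_emb using a by (auto simp: fls_inverse_subdegree)
  then have "val_ge (of_int (- fls_subdegree ?a)) (ev (smult (inverse ?a) f) \<gamma>)" if "\<gamma> \<in> roots" for \<gamma>
    using f(1) that by (simp only: ev_smult) (rule val_ge_mult'[where s = 0], auto simp: integral_def)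
  from integral_coefficients_suffice[OF lc this] obtain q' where
    "lead_coeff q' = 1" "degree q' = degree (smult (inverse ?a) f)"
    "\<And>\<gamma>. \<gamma> \<in> roots \<Longrightarrow> val_ge (of_int (- fls_subdegree ?a)) (ev (laurent_poly q') \<gamma>)" by blast
  moreover from this(2) have "degree q' = degree q" using f(2) a by simp
  ultimately show ?thesis
    using opt[unfolded integrality_optimal_def, THEN conjunct2, rule_format, of q' "- fls_subdegree ?a"]
    by blast
qed

text \<open>The bound on the order of the leading coefficient \<open>a\<close> says that \<open>a X\<^bsup>e(k)\<^esup>\<close> is a power series
\<open>u\<close>, and subtracting \<open>u\<close> times the \<open>k\<close>-th generator lowers the degree within the integral elements.\<close>

lemma optimal_imp_spanning:
  assumes p: "\<And>d. d < k \<Longrightarrow> lead_coeff (p d) = 1 \<and> degree (p d) = d"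
    and opt: "\<And>d. d < k \<Longrightarrow> integrality_optimal (p d) (e d)"
    and f: "integral f" "\<And>i. i \<ge> k \<Longrightarrow> coeff f i = 0"
  shows "\<exists>c. f = (\<Sum>d<k. smult (fps_to_fls (c d)) (scaled (p d) (e d)))"
  using assms
proof (induction k arbitrary: f)
  case 0
  then show ?case by (simp add: poly_eq_iff)
next
  case (Suc k)
  define a where "a = coeff f k"
  have pk: "lead_coeff (p k) = 1" "degree (p k) = k" using Suc.prems(1)[of k] by auto
  have "\<exists>u. a * fls_X_intpow (e k) = fps_to_fls u"
  proof (cases "a = 0")
    case False
    have "degree f = k"
      using Suc.prems(4) False unfolding a_def by (intro antisym degree_le le_degree) auto
    then have "- fls_subdegree a \<le> e k"
      using leading_subdegree_bound[of "p k" "e k" f] Suc.prems(2,3) pk False by (auto simp: a_def)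
    then have "fls_subdegree (a * fls_X_intpow (e k)) \<ge> 0"
      using False by (simp add: fls_subdegree_mult_fls_X_intpow)
    then show ?thesis using fls_regpart_if_nth_neg by (metis fls_eq0_below_subdegree less_le_trans)
  qed (simp add: exI[of _ 0])
  then obtain u where u: "a * fls_X_intpow (e k) = fps_to_fls u" by blast
  define h where "h = f - smult (fps_to_fls u) (scaled (p k) (e k))"
  have "integral (scaled (p k) (e k))"
    using Suc.prems(2)[of k] by (simp add: integral_scaled_iff integrality_optimal_def)
  then have hint: "integral h" unfolding h_def by (intro integral_diff integral_smult Suc.prems(3))
  have hcoeff: "coeff h i = 0" if "i \<ge> k" for i
  proof (cases "i = k")
    case True
    have "fps_to_fls u * fls_X_intpow (- e k) = a"
      unfolding u[symmetric] mult.assoc fls_X_intpow_times_fls_X_intpow by simp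
    then show ?thesis using True coeff_scaled_top[OF pk(1), of "e k"] pk(2) by (simp add: h_def a_def)
  next
    case False
    then have "i \<ge> Suc k" using that by simp
    then show ?thesis using Suc.prems(4)[of i] degree_scaled[of "p k" "e k"] pk(2)
      by (simp add: h_def coeff_eq_0)
  qed
  have "\<exists>c. h = (\<Sum>d<k. smult (fps_to_fls (c d)) (scaled (p d) (e d)))"
    by (rule Suc.IH[OF _ _ hint hcoeff]) (use Suc.prems(1,2) in \<open>blast intro: less_SucI\<close>)+
  then obtain c where c: "h = (\<Sum>d<k. smult (fps_to_fls (c d)) (scaled (p d) (e d)))" by blast
  have "f = h + smult (fps_to_fls u) (scaled (p k) (e k))" by (simp add: h_def)
  then have "f = (\<Sum>d<Suc k. smult (fps_to_fls ((c(k := u)) d)) (scaled (p d) (e d)))"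
    by (simp add: c)
  then show ?case by blast
qed

text \<open>If \<open>q\<close> is monic of degree \<open>d\<close> and \<open>q/X\<^sup>n\<close> is integral, the coefficient of \<open>Y\<^sup>d\<close> in its
expansion reads \<open>X\<^bsup>-n\<^esup> = c\<^sub>d X\<^bsup>-e(d)\<^esup>\<close> with \<open>c\<^sub>d\<close> a power series, so \<open>n \<le> e(d)\<close>.\<close>

lemma spanning_imp_optimal:
  assumes p: "\<And>d. d < k \<Longrightarrow> lead_coeff (p d) = 1 \<and> degree (p d) = d"
    and int: "\<And>d. d < k \<Longrightarrow> integral (scaled (p d) (e d))"
    and span: "\<And>f. integral f \<Longrightarrow> degree f < k \<Longrightarrow>
      \<exists>c. f = (\<Sum>d<k. smult (fps_to_fls (c d)) (scaled (p d) (e d)))"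
    and d: "d < k"
  shows "integrality_optimal (p d) (e d)"
  unfolding integrality_optimal_def
proof (intro conjI allI impI)
  show "\<forall>\<gamma>\<in>roots. val_ge (of_int (e d)) (ev (laurent_poly (p d)) \<gamma>)"
    using int[OF d] by (simp add: integral_scaled_iff)
  fix q n
  assume q: "lead_coeff q = 1" "degree q = degree (p d)"
    and val: "\<forall>\<gamma>\<in>roots. val_ge (of_int n) (ev (laurent_poly q) \<gamma>)"
  have degq: "degree q = d" using q(2) p[OF d] by simp
  then obtain c where c: "scaled q n = (\<Sum>j<k. smult (fps_to_fls (c j)) (scaled (p j) (e j)))"
    using span[of "scaled q n"] val d by (auto simp: integral_scaled_iff degree_scaled)
  have "coeff (scaled q n) d = fps_to_fls (c d) * lead_coeff (scaled (p d) (e d))"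
    unfolding c
  proof (rule triangular_combination_coeff[OF _ d])
    fix j assume j: "j < k"
    show "degree (scaled (p j) (e j)) = j" using p[OF j] by (simp add: degree_scaled)
    show "lead_coeff (scaled (p j) (e j)) \<noteq> 0"
      by (rule lead_coeff_scaled_nonzero[OF conjunct1[OF p[OF j]]])
  qed (use degq degree_scaled[of q n] in \<open>simp add: c[symmetric] coeff_eq_0\<close>)
  moreover have "coeff (scaled q n) d = fls_X_intpow (- n)"
    using coeff_scaled_top[OF q(1)] by (simp only: degq)
  moreover have "lead_coeff (scaled (p d) (e d)) = fls_X_intpow (- e d)"
    by (rule lead_coeff_scaled[OF conjunct1[OF p[OF d]]])
  ultimately have "fls_X_intpow (- n) = fps_to_fls (c d) * fls_X_intpow (- e d)" by metis
  then have eq: "fls_shift n (1 :: 'k fls) = fls_shift (e d) (fps_to_fls (c d))"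
    by (simp add: fls_X_intpow_times_conv_shift(2)[of _ "- e d", simplified])
  show "n \<le> e d"
  proof (rule ccontr)
    assume "\<not> n \<le> e d"
    then show False using arg_cong[OF eq, of "\<lambda>f. fls_nth f (- n)"] by simp
  qed
qed

section \<open>The total ring of fractions\<close>

abbreviation "R \<equiv> fraction_ring g"

lemma ring_of_type_algebra_simps:
  "carrier (ring_of_type_algebra :: 'k fls poly ring) = UNIV"
  "x \<otimes>\<^bsub>ring_of_type_algebra\<^esub> y = x * y" "x \<oplus>\<^bsub>ring_of_type_algebra\<^esub> y = x + y"
  "\<one>\<^bsub>ring_of_type_algebra\<^esub> = 1" "\<zero>\<^bsub>ring_of_type_algebra\<^esub> = 0"
  for x y :: "'k fls poly"
  by (simp_all add: ring_of_type_algebra_def)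

lemma fraction_ideal_ideal: "ideal (fraction_ideal g) (ring_of_type_algebra :: 'k fls poly ring)"
  by (rule cring.cgenideal_ideal[OF cring_from_type_algebra]) (simp add: ring_of_type_algebra_simps)

lemma residue_eq: "residue g f = {h. G dvd h - f}"
proof -
  have "fraction_ideal g = {h. G dvd h}"
    by (auto simp: cgenideal_def ring_of_type_algebra_simps dvd_def mult.commute)
  then have "residue g f = (\<lambda>h. h + f) ` {h. G dvd h}"
    by (auto simp: residue_def a_r_coset_def' ring_of_type_algebra_simps)
  also have "\<dots> = {h. G dvd h - f}"
    by (auto intro!: image_eqI[of _ _ "_ - f"])
  finally show ?thesis .
qed

lemma residue_eq_iff: "residue g f = residue g h \<longleftrightarrow> G dvd f - h"
proof
  assume *: "residue g f = residue g h"
  have "f \<in> residue g f" by (simp add: residue_eq)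
  then have "f \<in> residue g h" by (simp only: *)
  then show "G dvd f - h" by (simp add: residue_eq)
next
  assume *: "G dvd f - h"
  have "G dvd x - f \<longleftrightarrow> G dvd x - h" for x
  proof -
    have "x - h = (x - f) + (f - h)" by simp
    then show ?thesis by (simp only: dvd_add_left_iff[OF *])
  qed
  then show "residue g f = residue g h" by (simp only: residue_eq)
qed

lemma residue_hom: "residue g \<in> ring_hom ring_of_type_algebra R"
  unfolding residue_def[abs_def] fraction_ring_def
  by (rule ideal.rcos_ring_hom[OF fraction_ideal_ideal])

lemma carrier_R: "carrier R = range (residue g)"
  by (auto simp: fraction_ring_def FactRing_def A_RCOSETS_def' residue_def ring_of_type_algebra_simps)

lemma residue_mult: "residue g f \<otimes>\<^bsub>R\<^esub> residue g h = residue g (f * h)"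
  and residue_add: "residue g f \<oplus>\<^bsub>R\<^esub> residue g h = residue g (f + h)"
  and residue_one: "\<one>\<^bsub>R\<^esub> = residue g 1"
  using ring_hom_mult[OF residue_hom] ring_hom_add[OF residue_hom] ring_hom_one[OF residue_hom]
  by (simp_all add: ring_of_type_algebra_simps)

lemma cring_R: "cring R"
  unfolding fraction_ring_def
  by (rule ideal.quotient_is_cring[OF fraction_ideal_ideal cring_from_type_algebra])

sublocale R: cring R by (rule cring_R)

lemma residue_zero: "\<zero>\<^bsub>R\<^esub> = residue g 0"
proof -
  have "residue g 0 \<oplus>\<^bsub>R\<^esub> residue g 0 = residue g 0" by (simp add: residue_add)
  moreover have "residue g 0 \<in> carrier R" by (simp add: carrier_R)
  ultimately show ?thesis using R.add.r_cancel_one[of "residue g 0" "residue g 0"] by simp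
qed

lemma residue_closed [simp]: "residue g f \<in> carrier R" by (simp add: carrier_R)

lemma residue_pow: "residue g f [^]\<^bsub>R\<^esub> (n::nat) = residue g (f ^ n)"
  by (induction n) (simp_all add: residue_one residue_mult mult.commute)

lemma residue_finsum: "(\<Oplus>\<^bsub>R\<^esub>i\<in>A. residue g (f i)) = residue g (\<Sum>i\<in>A. f i)"
proof (induction A rule: infinite_finite_induct)
  case (insert i A)
  then show ?case by (subst R.finsum_insert) (auto simp: residue_add)
qed (simp_all add: residue_zero)

text \<open>The equation found for an integral \<open>f\<close> has coefficients in \<open>K[[X]]\<close>, hence in particular in the
coordinate ring. In the other direction, coefficients in the coordinate ring take integral values at the
roots of \<open>g\<close>, and the valuation ring is integrally closed.\<close>

lemma normalization_eq: "normalization g = residue g ` {f. integral f}"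
proof (intro equalityI subsetI)
  fix z assume "z \<in> normalization g"
  then have z: "z \<in> carrier R" "integral_over R (coordinate_ring g) z"
    by (simp_all add: normalization_def integral_closure_def)
  from z(1) obtain f where f: "z = residue g f" unfolding carrier_R by blast
  from z(2) obtain n c where c: "c \<in> {..<n} \<rightarrow> coordinate_ring g"
    "z [^]\<^bsub>R\<^esub> (n::nat) \<oplus>\<^bsub>R\<^esub> (\<Oplus>\<^bsub>R\<^esub>i\<in>{..<n}. c i \<otimes>\<^bsub>R\<^esub> (z [^]\<^bsub>R\<^esub> i)) = \<zero>\<^bsub>R\<^esub>"
    unfolding integral_over_def by blast
  have "\<forall>i\<in>{..<n}. \<exists>q. c i = residue g (laurent_poly q)"
    using c(1) by (auto simp: coordinate_ring_def Pi_iff)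
  from bchoice[OF this] obtain q where q: "\<And>i. i < n \<Longrightarrow> c i = residue g (laurent_poly (q i))"
    by auto
  have "(\<Oplus>\<^bsub>R\<^esub>i\<in>{..<n}. c i \<otimes>\<^bsub>R\<^esub> (z [^]\<^bsub>R\<^esub> i)) =
      (\<Oplus>\<^bsub>R\<^esub>i\<in>{..<n}. residue g (laurent_poly (q i) * f ^ i))"
    by (rule R.finsum_cong') (auto simp: q f residue_pow residue_mult)
  with c(2) have "residue g (f ^ n + (\<Sum>i<n. laurent_poly (q i) * f ^ i)) = residue g 0"
    by (simp add: f residue_pow residue_finsum residue_add residue_zero)
  then have "integral f" by (intro equation_imp_integral[of f n q]) (simp add: residue_eq_iff)
  with f show "z \<in> residue g ` {f. integral f}" by blast
next
  fix z assume "z \<in> residue g ` {f. integral f}"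
  then obtain f where f: "integral f" "z = residue g f" by blast
  from integral_imp_equation[OF f(1)] obtain c where
    "G dvd f ^ degree g + (\<Sum>i<degree g. laurent_poly [:c i:] * f ^ i)" by blast
  then have "residue g (f ^ degree g + (\<Sum>i<degree g. laurent_poly [:c i:] * f ^ i)) = residue g 0"
    by (simp add: residue_eq_iff)
  then have "z [^]\<^bsub>R\<^esub> degree g \<oplus>\<^bsub>R\<^esub>
      (\<Oplus>\<^bsub>R\<^esub>i\<in>{..<degree g}. residue g (laurent_poly [:c i:]) \<otimes>\<^bsub>R\<^esub> (z [^]\<^bsub>R\<^esub> i)) = \<zero>\<^bsub>R\<^esub>"
    by (simp add: f(2) residue_pow residue_mult residue_finsum residue_add residue_zero)
  moreover have "(\<lambda>i. residue g (laurent_poly [:c i:])) \<in> {..<degree g} \<rightarrow> coordinate_ring g"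
    by (auto simp: coordinate_ring_def)
  moreover have "degree g > 0" using degree_pos by simp
  ultimately have "integral_over R (coordinate_ring g) z"
    unfolding integral_over_def by (intro exI[of _ "degree g"] conjI bexI)
  then show "z \<in> normalization g"
    using f(2) by (simp add: normalization_def integral_closure_def)
qed

lemma residue_fraction_eq: "residue_fraction g q n = residue g (scaled q n)"
proof -
  let ?x = "residue g (laurent_poly [:fps_X:])"
  let ?c = "\<lambda>k. residue g [:fls_X_intpow k:]"
  have X: "laurent_poly [:fps_X:] = [:fls_X_intpow 1 :: 'k fls:]"
    by (rule poly_eqI) (simp add: coeff_pCons fls_X_conv_shift_1 split: nat.splits)
  have inv: "inv\<^bsub>R\<^esub> (?c k) = ?c (- k)" for k
  proof (rule R.comm_inv_char)
    have "[:fls_X_intpow k:] * [:fls_X_intpow (- k):] = (1 :: 'k fls poly)"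
      using fls_X_intpow_times_fls_X_intpow[of k "- k", where 'a = 'k] by (simp add: one_pCons mult.commute)
    then show "?c k \<otimes>\<^bsub>R\<^esub> ?c (- k) = \<one>\<^bsub>R\<^esub>" by (simp only: residue_mult residue_one)
  qed simp_all
  have "[:fls_X_intpow 1 :: 'k fls:] ^ k = [:fls_X_intpow (int k):]" for k
    by (simp add: poly_const_pow fls_X_intpow_power)
  then have pow: "?x [^]\<^bsub>R\<^esub> k = ?c (int k)" for k :: nat by (simp add: X residue_pow)
  have "?x [^]\<^bsub>R\<^esub> n = ?c n"
    using inv[of "- n"] by (simp add: int_pow_def2 pow)
  then show ?thesis
    by (simp add: residue_fraction_def inv residue_mult scaled_def)
qed

section \<open>The criterion for integral bases\<close>

lemma residue_inject_low_degree:
  assumes "residue g f = residue g h" "degree f < degree g" "degree h < degree g"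
  shows "f = h"
proof (rule ccontr)
  assume "f \<noteq> h"
  moreover have "G dvd f - h" using assms(1) by (simp add: residue_eq_iff)
  ultimately have "degree G \<le> degree (f - h)" by (intro dvd_imp_degree_le) auto
  moreover have "degree (f - h) < degree g" by (rule degree_diff_less) (use assms in auto)
  ultimately show False by simp
qed

text \<open>Every class has a unique representative of degree below that of \<open>g\<close>, so statements about the
quotient become statements about polynomials. Uniqueness of coordinates does not appear on the right
because polynomials of distinct degrees are linearly independent.\<close>

lemma free_generators_iff:
  assumes p: "\<And>d. d < degree g \<Longrightarrow> lead_coeff (p d) = 1 \<and> degree (p d) = d"
  shows "free_generators R (base_ring g) (normalization g) ((\<lambda>d. residue g (scaled (p d) (e d))) ` {..<degree g})
    \<longleftrightarrow> (\<forall>d<degree g. integral (scaled (p d) (e d))) \<and>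
      (\<forall>f. integral f \<longrightarrow> degree f < degree g \<longrightarrow>
        (\<exists>c. f = (\<Sum>d<degree g. smult (fps_to_fls (c d)) (scaled (p d) (e d)))))"
    (is "?L \<longleftrightarrow> ?R")
proof -
  let ?m = "degree g"
  let ?b = "\<lambda>d. scaled (p d) (e d)"
  let ?\<beta> = "\<lambda>d. residue g (?b d)"
  let ?S = "?\<beta> ` {..<?m}"
  have degb: "degree (?b d) = d" if "d < ?m" for d using p[OF that] by (simp add: degree_scaled)
  have inj: "inj_on ?\<beta> {..<?m}"
  proof (rule inj_onI)
    fix i j assume ij: "i \<in> {..<?m}" "j \<in> {..<?m}" "?\<beta> i = ?\<beta> j"
    then have "?b i = ?b j" by (intro residue_inject_low_degree) (simp_all add: degb)
    then have "degree (?b i) = degree (?b j)" by (rule arg_cong)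
    with ij show "i = j" by (simp add: degb)
  qed
  have const: "laurent_poly [:u:] * f = smult (fps_to_fls u) f" for u :: "'k fps" and f
  proof -
    have "laurent_poly [:u:] = [:fps_to_fls u:]"
      by (rule poly_eqI) (simp add: coeff_pCons split: nat.splits)
    then show ?thesis by simp
  qed
  have sum: "(\<Oplus>\<^bsub>R\<^esub>s\<in>?S. c s \<otimes>\<^bsub>R\<^esub> s) = residue g (\<Sum>d<?m. smult (fps_to_fls (u d)) (?b d))"
    if "\<And>d. d < ?m \<Longrightarrow> c (?\<beta> d) = residue g (laurent_poly [:u d:])" for c u
  proof -
    have "(\<Oplus>\<^bsub>R\<^esub>s\<in>?S. c s \<otimes>\<^bsub>R\<^esub> s) = (\<Oplus>\<^bsub>R\<^esub>d\<in>{..<?m}. c (?\<beta> d) \<otimes>\<^bsub>R\<^esub> ?\<beta> d)"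
      by (rule R.finsum_reindex[OF _ inj]) (auto simp: that residue_mult)
    also have "\<dots> = (\<Oplus>\<^bsub>R\<^esub>d\<in>{..<?m}. residue g (smult (fps_to_fls (u d)) (?b d)))"
      by (rule R.finsum_cong') (auto simp: that residue_mult const)
    finally show ?thesis by (simp add: residue_finsum)
  qed
  have base: "\<exists>u. \<forall>d<?m. c (?\<beta> d) = residue g (laurent_poly [:u d:])" if "c \<in> ?S \<rightarrow>\<^sub>E base_ring g" for c
  proof -
    have "\<forall>d\<in>{..<?m}. \<exists>u. c (?\<beta> d) = residue g (laurent_poly [:u:])"
    proof
      fix d assume "d \<in> {..<?m}"
      then have "c (?\<beta> d) \<in> base_ring g" by (intro PiE_mem[OF that] imageI)
      then show "\<exists>u. c (?\<beta> d) = residue g (laurent_poly [:u:])" unfolding base_ring_def by blast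
    qed
    from bchoice[OF this] show ?thesis by auto
  qed
  have deg_sum: "degree (\<Sum>d<?m. smult (F d) (?b d)) < ?m" for F
    using degree_pos degb by (intro degree_sum_less) (auto intro: le_less_trans[OF degree_smult_le])
  show ?thesis
  proof
    assume L: ?L
    have "integral (?b d)" if "d < ?m" for d
    proof -
      have "?\<beta> d \<in> normalization g" using L that by (auto simp: free_generators_def)
      then obtain f where f: "integral f" "?\<beta> d = residue g f" by (auto simp: normalization_eq)
      then have "G dvd ?b d - f" by (simp add: residue_eq_iff)
      then have "ev (?b d) \<gamma> = ev f \<gamma>" if "\<gamma> \<in> roots" for \<gamma>
        using that by (auto simp: G_dvd_iff ev_diff)
      with f(1) show ?thesis by (simp add: integral_def)
    qed
    moreover have "\<exists>c. f = (\<Sum>d<?m. smult (fps_to_fls (c d)) (?b d))"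
      if f: "integral f" "degree f < ?m" for f
    proof -
      have "residue g f \<in> normalization g" using f(1) by (auto simp: normalization_eq)
      then obtain c where c: "c \<in> ?S \<rightarrow>\<^sub>E base_ring g" "residue g f = (\<Oplus>\<^bsub>R\<^esub>s\<in>?S. c s \<otimes>\<^bsub>R\<^esub> s)"
        using L by (auto simp: free_generators_def)
      obtain u where "\<forall>d<?m. c (?\<beta> d) = residue g (laurent_poly [:u d:])" using base[OF c(1)] by blast
      with c(2) sum[of c u] have "residue g f = residue g (\<Sum>d<?m. smult (fps_to_fls (u d)) (?b d))"
        by simp
      from residue_inject_low_degree[OF this f(2) deg_sum] show ?thesis by (rule exI[of _ u])
    qed
    ultimately show ?R by blast
  next
    assume R: ?R
    have "\<exists>!c. c \<in> ?S \<rightarrow>\<^sub>E base_ring g \<and> z = (\<Oplus>\<^bsub>R\<^esub>s\<in>?S. c s \<otimes>\<^bsub>R\<^esub> s)" if z: "z \<in> normalization g" for z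
    proof (rule ex_ex1I)
      obtain f where f: "integral f" "z = residue g f" using z by (auto simp: normalization_eq)
      define r where "r = f mod G"
      have "G dvd f - r" by (simp add: r_def minus_mod_eq_mult_div)
      then have zr: "z = residue g r" by (simp add: f(2) residue_eq_iff)
      from \<open>G dvd f - r\<close> have "ev f \<gamma> = ev r \<gamma>" if "\<gamma> \<in> roots" for \<gamma>
        using that by (auto simp: G_dvd_iff ev_diff)
      with f(1) have "integral r" by (simp add: integral_def)
      moreover have "degree r < ?m"
        using degree_mod_less[OF G_nonzero, of f] degree_pos by (auto simp: r_def)
      ultimately obtain u where u: "r = (\<Sum>d<?m. smult (fps_to_fls (u d)) (?b d))" using R by blast
      define c where "c = restrict (\<lambda>s. residue g (laurent_poly [:u (the_inv_into {..<?m} ?\<beta> s):])) ?S"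
      have c: "c (?\<beta> d) = residue g (laurent_poly [:u d:])" if "d < ?m" for d
        using that by (simp add: c_def the_inv_into_f_f[OF inj])
      have "c \<in> ?S \<rightarrow>\<^sub>E base_ring g" by (auto simp: c_def base_ring_def)
      moreover have "z = (\<Oplus>\<^bsub>R\<^esub>s\<in>?S. c s \<otimes>\<^bsub>R\<^esub> s)" using sum[of c u] c by (simp add: zr u)
      ultimately show "\<exists>c. c \<in> ?S \<rightarrow>\<^sub>E base_ring g \<and> z = (\<Oplus>\<^bsub>R\<^esub>s\<in>?S. c s \<otimes>\<^bsub>R\<^esub> s)" by blast
    next
      fix c c'
      assume c: "c \<in> ?S \<rightarrow>\<^sub>E base_ring g \<and> z = (\<Oplus>\<^bsub>R\<^esub>s\<in>?S. c s \<otimes>\<^bsub>R\<^esub> s)"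
        and c': "c' \<in> ?S \<rightarrow>\<^sub>E base_ring g \<and> z = (\<Oplus>\<^bsub>R\<^esub>s\<in>?S. c' s \<otimes>\<^bsub>R\<^esub> s)"
      obtain u where u: "\<forall>d<?m. c (?\<beta> d) = residue g (laurent_poly [:u d:])" using base[OF conjunct1[OF c]] by blast
      obtain u' where u': "\<forall>d<?m. c' (?\<beta> d) = residue g (laurent_poly [:u' d:])" using base[OF conjunct1[OF c']] by blast
      have "z = residue g (\<Sum>d<?m. smult (fps_to_fls (u d)) (?b d))"
        by (rule trans[OF conjunct2[OF c] sum]) (use u in blast)
      moreover have "z = residue g (\<Sum>d<?m. smult (fps_to_fls (u' d)) (?b d))"
        by (rule trans[OF conjunct2[OF c'] sum]) (use u' in blast)
      ultimately have "residue g (\<Sum>d<?m. smult (fps_to_fls (u d)) (?b d)) =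
          residue g (\<Sum>d<?m. smult (fps_to_fls (u' d)) (?b d))"
        by (simp only:)
      then have "(\<Sum>d<?m. smult (fps_to_fls (u d)) (?b d)) = (\<Sum>d<?m. smult (fps_to_fls (u' d)) (?b d))"
        by (rule residue_inject_low_degree) (rule deg_sum)+
      then have zero: "(\<Sum>d<?m. smult (fps_to_fls (u d) - fps_to_fls (u' d)) (?b d)) = 0"
        by (simp add: smult_diff_left sum_subtractf)
      have "u d = u' d" if d: "d < ?m" for d
      proof -
        have lead: "lead_coeff (?b j) \<noteq> 0" if "j < ?m" for j
          by (rule lead_coeff_scaled_nonzero[OF conjunct1[OF p[OF that]]])
        have "coeff (\<Sum>d<?m. smult (fps_to_fls (u d) - fps_to_fls (u' d)) (?b d)) d =
            (fps_to_fls (u d) - fps_to_fls (u' d)) * lead_coeff (?b d)"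
          by (rule triangular_combination_coeff[OF degb d _ lead]) (simp_all only: zero coeff_0)
        then have "(fps_to_fls (u d) - fps_to_fls (u' d)) * lead_coeff (?b d) = 0"
          unfolding zero by simp
        then show ?thesis using lead[OF d] by simp
      qed
      then have "c (?\<beta> d) = c' (?\<beta> d)" if "d < ?m" for d using that u u' by simp
      then have "c s = c' s" if "s \<in> ?S" for s using that by blast
      then show "c = c'" by (rule PiE_ext[OF conjunct1[OF c] conjunct1[OF c']])
    qed
    moreover have "?S \<subseteq> normalization g" using R by (auto simp: normalization_eq)
    moreover have "finite ?S" by simp
    ultimately show ?L unfolding free_generators_def by (intro conjI ballI)
  qed
qed

theorem free_generators_iff_optimal:
  assumes p: "\<And>d. d < degree g \<Longrightarrow> lead_coeff (p d) = 1 \<and> degree (p d) = d"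
  shows "integral_basis g ((\<lambda>d. residue g (scaled (p d) (e d))) ` {..<degree g})
    \<longleftrightarrow> (\<forall>d<degree g. integrality_optimal (p d) (e d))"
proof -
  have "integral_basis g ((\<lambda>d. residue g (scaled (p d) (e d))) ` {..<degree g})
    \<longleftrightarrow> (\<forall>d<degree g. integral (scaled (p d) (e d))) \<and>
      (\<forall>f. integral f \<longrightarrow> degree f < degree g \<longrightarrow>
        (\<exists>c. f = (\<Sum>d<degree g. smult (fps_to_fls (c d)) (scaled (p d) (e d)))))"
    (is "_ \<longleftrightarrow> ?spanning")
    unfolding integral_basis_def by (rule free_generators_iff[OF p])
  also have "\<dots> \<longleftrightarrow> (\<forall>d<degree g. integrality_optimal (p d) (e d))"
  proof
    assume sp: ?spanning
    show "\<forall>d<degree g. integrality_optimal (p d) (e d)"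
    proof (intro allI impI)
      fix d assume "d < degree g"
      with sp show "integrality_optimal (p d) (e d)"
        by (intro spanning_imp_optimal[OF p]) simp_all
    qed
  next
    assume opt: "\<forall>d<degree g. integrality_optimal (p d) (e d)"
    then have "\<forall>d<degree g. integral (scaled (p d) (e d))"
      by (simp add: integrality_optimal_def integral_scaled_iff)
    moreover have "\<exists>c. f = (\<Sum>d<degree g. smult (fps_to_fls (c d)) (scaled (p d) (e d)))"
      if "integral f" "degree f < degree g" for f
      by (rule optimal_imp_spanning[OF p]) (use opt that in \<open>auto simp: coeff_eq_0\<close>)
    ultimately show ?spanning by blast
  qed
  finally show ?thesis .
qed

end

theorem proposition35:
  fixes \<iota> :: "'k::field_char_0 \<Rightarrow> 'l::{alg_closed_field, field_char_0}"
    and g :: "'k fps poly" and m :: nat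
    and p :: "nat \<Rightarrow> 'k fps poly" and e :: "nat \<Rightarrow> int"
  assumes "\<iota> \<in> ring_hom ring_of_type_algebra ring_of_type_algebra"
    and "lead_coeff g = 1" and "degree g = m" and "m \<ge> 1" and "squarefree g"
    and "\<And>d. d \<in> {1..<m} \<Longrightarrow> lead_coeff (p d) = 1 \<and> degree (p d) = d"
  shows "integral_basis g
           (insert \<one>\<^bsub>fraction_ring g\<^esub> ((\<lambda>d. residue_fraction g (p d) (e d)) ` {1..<m}))
     \<longleftrightarrow> (\<forall>d\<in>{1..<m}. e d = integrality_exponent \<iota> g (p d) \<and>
            integrality_exponent \<iota> g (p d) = max_integrality_exponent \<iota> g d)"
proof -
  have "unital_hom \<iota>"
    using ring_hom_mult[OF assms(1)] ring_hom_add[OF assms(1)] ring_hom_one[OF assms(1)]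
    by unfold_locales (simp_all add: ring_of_type_algebra_def)
  then interpret squarefree_over_power_series \<iota> g
    using assms(2-5) by unfold_locales (auto simp: unital_hom_def)
  \<comment> \<open>The element 1 is treated as the member of degree 0, with exponent 0.\<close>
  define p' where "p' = p(0 := 1)"
  define e' where "e' = e(0 := 0)"
  have p': "lead_coeff (p' d) = 1 \<and> degree (p' d) = d" if "d < degree g" for d
    using that assms(3) assms(6)[of d] by (cases "d = 0") (auto simp: p'_def)
  have split: "{..<m} = insert 0 {1..<m}" using assms(4) by auto
  have "residue g (scaled (p' 0) (e' 0)) = \<one>\<^bsub>fraction_ring g\<^esub>"
    by (simp add: p'_def e'_def scaled_def lp.hom_one residue_one pCons_one)
  moreover have "(\<lambda>d. residue g (scaled (p' d) (e' d))) ` {1..<m} =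
      (\<lambda>d. residue_fraction g (p d) (e d)) ` {1..<m}"
    by (rule image_cong) (auto simp: p'_def e'_def residue_fraction_eq)
  ultimately have "(\<lambda>d. residue g (scaled (p' d) (e' d))) ` {..<m} =
      insert \<one>\<^bsub>fraction_ring g\<^esub> ((\<lambda>d. residue_fraction g (p d) (e d)) ` {1..<m})"
    by (simp only: split image_insert)
  then have "integral_basis g
        (insert \<one>\<^bsub>fraction_ring g\<^esub> ((\<lambda>d. residue_fraction g (p d) (e d)) ` {1..<m}))
      \<longleftrightarrow> (\<forall>d<m. integrality_optimal (p' d) (e' d))"
    using free_generators_iff_optimal[OF p', of e'] assms(3) by simp
  also have "\<dots> \<longleftrightarrow> (\<forall>d\<in>{1..<m}. integrality_optimal (p d) (e d))"
  proof -
    have "(\<forall>d<m. integrality_optimal (p' d) (e' d)) \<longleftrightarrow> (\<forall>d\<in>{..<m}. integrality_optimal (p' d) (e' d))"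
      by auto
    also have "\<dots> \<longleftrightarrow> (\<forall>d\<in>{1..<m}. integrality_optimal (p d) (e d))"
      unfolding split by (auto simp: p'_def e'_def integrality_optimal_one)
    finally show ?thesis .
  qed
  also have "\<dots> \<longleftrightarrow> (\<forall>d\<in>{1..<m}. e d = integrality_exponent \<iota> g (p d) \<and>
            integrality_exponent \<iota> g (p d) = max_integrality_exponent \<iota> g d)"
  proof (intro ball_cong refl)
    fix d assume d: "d \<in> {1..<m}"
    then have "degree (p d) < degree g" using assms(3) assms(6)[OF d] by simp
    from integrality_optimal_iff[OF conjunct1[OF assms(6)[OF d]] this, of "e d"]
    show "integrality_optimal (p d) (e d) \<longleftrightarrow> e d = integrality_exponent \<iota> g (p d) \<and>
            integrality_exponent \<iota> g (p d) = max_integrality_exponent \<iota> g d"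
      by (simp only: conjunct2[OF assms(6)[OF d]])
  qed
  finally show ?thesis .
qed

end
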